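(* Let $A$ be a linear operator on a Banach space $X$ satisfying the resolvent condition and the forcing condition, and let $\{B(t)\}_{t\in\mathbb R}\subset\mathcal L(X_0,X)$ satisfy the perturbation condition. Then for each $t_0\in\mathbb R$, each $x_0\in X_0$ and each $f\in C([t_0,+\infty),X)$, the unique integrated solution $u_f\in C([t_0,+\infty),X_0)$ of $$\frac{du(t)}{dt}=(A+B(t))u(t)+f(t),\ t\ge t_0,\qquad u(t_0)=x_0,$$ is given by $$u_f(t)=U_B(t,t_0)x_0+\lim_{\lambda\to+\infty}\int_{t_0}^tU_B(t,s)\,\lambda R_\lambda(A)f(s)\,ds,\qquad \forall t\ge t_0,$$ where the limit exists in $X_0$. Moreover, the convergence is uniform with respect to $t,t_0$ in compact intervals: if $f\in C(\mathbb R,X)$ and $I\subset\mathbb R$ is a compact interval, then the limit of $\int_{t_0}^tU_B(t,s)\,\lambda R_\lambda(A)f(s)\,ds$ as $\lambda\to+\infty$ is uniform with respect to $t,t_0\in I$ with $t\ge t_0$.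
   Context: $(X,\|\cdot\|)$ is a Banach space, $A:D(A)\subset X\to X$ is a linear operator (its domain need not be dense), $X_0:=\overline{D(A)}$ with the norm of $X$, $\rho(A)$ is the resolvent set, $R_\lambda(A):=(\lambda I-A)^{-1}$, and $\Delta:=\{(t,s)\in\mathbb R^2:t\ge s\}$. Resolvent condition: there are fixed $\omega\in\mathbb R$, $M\ge1$ with $(\omega,+\infty)\subset\rho(A)$, $\|(\lambda I-A)^{-k}\|_{\mathcal L(X_0)}\le M(\lambda-\omega)^{-k}$ for all $\lambda>\omega$, $k\ge1$, and $\lim_{\lambda\to+\infty}(\lambda I-A)^{-1}x=0$ for all $x\in X$. Forcing condition: for each $\tau>0$ and $f\in C([0,\tau],X)$ there is $u_f\in C([0,\tau],X_0)$ with $\int_0^tu_f(s)ds\in D(A)$ and $u_f(t)=A\int_0^tu_f(s)ds+\int_0^tf(s)ds$ for all $t\in[0,\tau]$; moreover there is a non decreasing $\delta:[0,+\infty)\to[0,+\infty)$ (independent of $f,\tau$) with $\delta(t)\to0$ as $t\to0^+$ and $\|u_f(t)\|\le\delta(t)\sup_{s\in[0,t]}\|f(s)\|$. Perturbation condition: $B(t)\in\mathcal L(X_0,X)$ for $t\in\mathbb R$, $t\mapsto B(t)x$ is continuous from $\mathbb R$ into $X$ for each $x\in X_0$, and there is $b\in C(\mathbb R,\mathbb R_+)$ with $\|B(t)\|_{\mathcal L(X_0,X)}\le b(t)$ for all $t\in\mathbb R$. An integrated solution on $[t_0,+\infty)$ of $u'=(A+B(t))u+f$, $u(t_0)=x$,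 is $u\in C([t_0,+\infty),X_0)$ such that for all $t\ge t_0$: $\int_{t_0}^tu(r)dr\in D(A)$ and $u(t)=x+A\int_{t_0}^tu(r)dr+\int_{t_0}^t[B(r)u(r)+f(r)]dr$. Under the three conditions it exists and is unique for each $t_0\in\mathbb R$, $x\in X_0$, $f\in C([t_0,+\infty),X)$. An evolution family on a Banach space $Z$ is $\{U(t,s)\}_{(t,s)\in\Delta}\subset\mathcal L(Z)$ with $U(t,t)=I$, $U(t,r)U(r,s)=U(t,s)$ for $t\ge r\ge s$, and $(t,s)\mapsto U(t,s)x$ continuous on $\Delta$ for each $x\in Z$. $\{U_B(t,s)\}_{(t,s)\in\Delta}\subset\mathcal L(X_0)$ denotes the evolution family generated by the homogeneous problem: $t\mapsto U_B(t,t_0)x_0$ is the unique integrated solution on $[t_0,+\infty)$ with $f=0$ and initial value $x_0\in X_0$ at $t_0$. *)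

theory Defs
  imports "HOL-Analysis.Analysis"
begin

section \<open>Linear maps between subspaces\<close>

text \<open>Partially defined operators are pairs of a domain and a total function; the values of the
  function outside the domain are never used.\<close>

definition linear_on :: "'a::real_vector set \<Rightarrow> 'b::real_vector set \<Rightarrow> ('a \<Rightarrow> 'b) \<Rightarrow> bool" where
  "linear_on S T f \<longleftrightarrow> subspace S \<and> subspace T \<and> f ` S \<subseteq> T \<and>
     (\<forall>x\<in>S. \<forall>y\<in>S. f (x + y) = f x + f y) \<and>
     (\<forall>c. \<forall>x\<in>S. f (c *\<^sub>R x) = c *\<^sub>R f x)"

definition bounded_linear_on ::
    "'a::real_normed_vector set \<Rightarrow> 'b::real_normed_vector set \<Rightarrow> ('a \<Rightarrow> 'b) \<Rightarrow> bool" where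
  "bounded_linear_on S T f \<longleftrightarrow> linear_on S T f \<and> (\<exists>K. \<forall>x\<in>S. norm (f x) \<le> K * norm x)"

text \<open>As for \<^const>\<open>onorm\<close>, the convention \<open>x / 0 = 0\<close> makes the point \<open>0\<close> harmless. The value is
  meaningful only when the map is bounded on \<open>S\<close>.\<close>

definition onorm_on :: "'a::real_normed_vector set \<Rightarrow> ('a \<Rightarrow> 'b::real_normed_vector) \<Rightarrow> real" where
  "onorm_on S f = (SUP x\<in>S. norm (f x) / norm x)"


section \<open>The unbounded operator and its resolvent\<close>

text \<open>Only real spectral parameters are considered, \<open>X\<close> being a real Banach space (a complex one
  is in particular a real one).\<close>

definition resolvent :: "'a::real_normed_vector set \<Rightarrow> ('a \<Rightarrow> 'a) \<Rightarrow> real \<Rightarrow> 'a \<Rightarrow> 'a" where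
  "resolvent D A l = the_inv_into D (\<lambda>x. l *\<^sub>R x - A x)"

definition resolvent_set :: "'a::real_normed_vector set \<Rightarrow> ('a \<Rightarrow> 'a) \<Rightarrow> real set" where
  "resolvent_set D A =
     {l. bij_betw (\<lambda>x. l *\<^sub>R x - A x) D UNIV \<and> bounded_linear (resolvent D A l)}"

text \<open>The space \<open>X\<^sub>0\<close> is \<^term>\<open>closure D\<close>. The resolvent maps \<open>X\<close> into \<open>D\<close>, so its iterates leave
  \<open>X\<^sub>0\<close> invariant.\<close>

definition resolvent_condition :: "'a::banach set \<Rightarrow> ('a \<Rightarrow> 'a) \<Rightarrow> bool" where
  "resolvent_condition D A \<longleftrightarrow>
     (\<exists>\<omega> M. M \<ge> 1 \<and> {\<omega><..} \<subseteq> resolvent_set D A \<and>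
        (\<forall>l>\<omega>. \<forall>k\<ge>1. onorm_on (closure D) (resolvent D A l ^^ k) \<le> M / (l - \<omega>) ^ k)) \<and>
     (\<forall>x. ((\<lambda>l. resolvent D A l x) \<longlongrightarrow> 0) at_top)"

definition forcing_condition :: "'a::banach set \<Rightarrow> ('a \<Rightarrow> 'a) \<Rightarrow> bool" where
  "forcing_condition D A \<longleftrightarrow>
     (\<exists>\<delta> :: real \<Rightarrow> real.
        (\<forall>t\<ge>0. \<delta> t \<ge> 0) \<and> mono_on {0..} \<delta> \<and> (\<delta> \<longlongrightarrow> 0) (at_right 0) \<and>
        (\<forall>\<tau>>0. \<forall>f. continuous_on {0..\<tau>} f \<longrightarrow>
           (\<exists>u. continuous_on {0..\<tau>} u \<and> u ` {0..\<tau>} \<subseteq> closure D \<and>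
              (\<forall>t\<in>{0..\<tau>}. integral {0..t} u \<in> D \<and>
                 u t = A (integral {0..t} u) + integral {0..t} f \<and>
                 norm (u t) \<le> \<delta> t * (SUP s\<in>{0..t}. norm (f s))))))"

definition perturbation_condition :: "'a::banach set \<Rightarrow> (real \<Rightarrow> 'a \<Rightarrow> 'a) \<Rightarrow> bool" where
  "perturbation_condition D B \<longleftrightarrow>
     (\<forall>t. bounded_linear_on (closure D) UNIV (B t)) \<and>
     (\<forall>x\<in>closure D. continuous_on UNIV (\<lambda>t. B t x)) \<and>
     (\<exists>b :: real \<Rightarrow> real. continuous_on UNIV b \<and>
        (\<forall>t. 0 \<le> b t \<and> onorm_on (closure D) (B t) \<le> b t))"


section \<open>Integrated solutions and the evolution family\<close>

definition integrated_solution ::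
    "'a::banach set \<Rightarrow> ('a \<Rightarrow> 'a) \<Rightarrow> (real \<Rightarrow> 'a \<Rightarrow> 'a) \<Rightarrow> (real \<Rightarrow> 'a) \<Rightarrow> real \<Rightarrow> 'a \<Rightarrow> (real \<Rightarrow> 'a) \<Rightarrow> bool" where
  "integrated_solution D A B f t0 x u \<longleftrightarrow>
     continuous_on {t0..} u \<and> u ` {t0..} \<subseteq> closure D \<and>
     (\<forall>t\<ge>t0. integral {t0..t} u \<in> D \<and>
        u t = x + A (integral {t0..t} u) + integral {t0..t} (\<lambda>r. B r (u r) + f r))"

text \<open>Solutions are total functions and hence unique only on \<^term>\<open>{t0..}\<close>; this is why the
  description operator is applied to the value at \<open>t\<close> rather than to the solution. Meaningful for
  \<open>t \<ge> s\<close> and \<open>x\<close> in \<^term>\<open>closure D\<close>.\<close>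

definition evol ::
    "'a::banach set \<Rightarrow> ('a \<Rightarrow> 'a) \<Rightarrow> (real \<Rightarrow> 'a \<Rightarrow> 'a) \<Rightarrow> real \<Rightarrow> real \<Rightarrow> 'a \<Rightarrow> 'a" where
  "evol D A B t s x = (THE y. \<exists>u. integrated_solution D A B (\<lambda>_. 0) s x u \<and> u t = y)"

definition approx_convolution ::
    "'a::banach set \<Rightarrow> ('a \<Rightarrow> 'a) \<Rightarrow> (real \<Rightarrow> 'a \<Rightarrow> 'a) \<Rightarrow> (real \<Rightarrow> 'a) \<Rightarrow> real \<Rightarrow> real \<Rightarrow> real \<Rightarrow> 'a" where
  "approx_convolution D A B f l t t0 =
     integral {t0..t} (\<lambda>s. evol D A B t s (l *\<^sub>R resolvent D A l (f s)))"

end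

theory Submission
  imports Defs
begin

text \<open>For \<open>x \<in> D(A)\<close> the function \<open>x + u\<close> with \<open>u\<close> forced by the constant \<open>A x\<close> solves the
  homogeneous problem, and stability of the implicit Euler scheme under the resolvent estimates
  extends this to all of \<open>X\<^sub>0\<close>. Perturbed solutions come from Picard iteration on intervals so short
  that \<open>\<delta>(h) sup b \<le> 1/2\<close>, which also yields a bound by initial value and forcing.

  As \<open>\<lambda> R\<^sub>\<lambda>(A) f\<close> takes values in \<open>X\<^sub>0\<close>, its convolution with \<open>U\<^sub>B\<close> solves the perturbed problem
  with that forcing. The scaled resolvent commutes with the unperturbed solution operator, so
  replacing \<open>f\<close> by \<open>\<lambda> R\<^sub>\<lambda>(A) f\<close> changes the unperturbed solution by \<open>\<lambda> R\<^sub>\<lambda>(A) - I\<close> applied to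
  values in a compact subset of \<open>X\<^sub>0\<close>, where that operator tends to zero uniformly.\<close>

section \<open>Integrals over triangles and in subspaces\<close>

text \<open>The forcing may leave \<open>X\<^sub>0\<close>, where the evolution family is undefined.
  There the scaled resolvent cannot converge to the identity, because its values stay in
  \<open>X\<^sub>0\<close>, and the power estimates, being stated on \<open>X\<^sub>0\<close>, do
  not bound it either. So no limit can be taken under the integral sign; convergence appears only
  after solving and is obtained by comparing solutions.

  The difference of the two forcing terms, which need not be small, is removed by cancellation. If
  \<open>Z\<close> is the unperturbed solution with forcing \<open>f\<close> and zero start, then
  \<open>z = \<lambda> R\<^sub>\<lambda>(A) Z - Z\<close> solves the unperturbed problem with
  exactly that difference as forcing. Subtracting \<open>z\<close> from the difference of the two
  perturbed solutions leaves a perturbed solution with forcing \<open>B z\<close>, and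
  \<open>z\<close> is small.

  Uniformity in the starting time comes from writing every such \<open>Z\<close> through one fixed
  solution on the whole interval, and from choosing every constant for a compact interval rather
  than for an individual solution.\<close>

lemma norm_add3_le: "norm (x + y + z) \<le> norm x + norm y + norm (z :: 'a::real_normed_vector)"
  using norm_triangle_ineq[of "x + y" z] norm_triangle_ineq[of x y] by linarith

text \<open>\<open>P\<close> is arbitrary off \<open>S\<close>, so it is applied to Riemann sums
  only: the tags lie in \<open>{a..b}\<close>, hence the sums stay in \<open>S\<close>. One division
  fine for both gauges approximates both integrals at once.\<close>

lemma integral_bounded_linear_on:
  fixes f :: "real \<Rightarrow> 'a::banach" and P :: "'a \<Rightarrow> 'b::banach"
  assumes P: "bounded_linear_on S UNIV P" and "closed S"
    and f: "continuous_on {a..b} f" "f ` {a..b} \<subseteq> S"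
    and Pf: "continuous_on {a..b} (\<lambda>s. P (f s))"
  shows "integral {a..b} f \<in> S" "P (integral {a..b} f) = integral {a..b} (\<lambda>s. P (f s))"
proof -
  have S: "subspace S" and add: "\<And>x y. x \<in> S \<Longrightarrow> y \<in> S \<Longrightarrow> P (x + y) = P x + P y"
    and scale: "\<And>c x. x \<in> S \<Longrightarrow> P (c *\<^sub>R x) = c *\<^sub>R P x"
    using P by (auto simp: bounded_linear_on_def linear_on_def)
  obtain K where K: "\<And>x. x \<in> S \<Longrightarrow> norm (P x) \<le> K * norm x"
    using P by (auto simp: bounded_linear_on_def)
  have P0: "P 0 = 0" using scale[of 0 0] subspace_0[OF S] by simp
  have Psum: "sum g p \<in> S \<and> P (sum g p) = (\<Sum>z\<in>p. P (g z))"
    if "finite p" "\<And>z. z \<in> p \<Longrightarrow> g z \<in> S" for p :: "(real \<times> real set) set" and g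
    using that by (induction p) (auto simp: P0 subspace_0[OF S] add subspace_add[OF S])
  have approx: "\<exists>y\<in>S. norm (y - integral {a..b} f) < e \<and>
      norm (P y - integral {a..b} (\<lambda>s. P (f s))) < e" if "e > 0" for e
  proof -
    have "(f has_integral integral {a..b} f) {a..b}"
      "((\<lambda>s. P (f s)) has_integral integral {a..b} (\<lambda>s. P (f s))) {a..b}"
      using f Pf by (auto intro!: integrable_integral integrable_continuous_real)
    then obtain d d' where d: "gauge d" "gauge d'"
      and D: "\<And>p. p tagged_division_of {a..b} \<and> d fine p \<Longrightarrow>
          norm (sum (\<lambda>(x,k). measure lborel k *\<^sub>R f x) p - integral {a..b} f) < e"
      and D': "\<And>p. p tagged_division_of {a..b} \<and> d' fine p \<Longrightarrow>
          norm (sum (\<lambda>(x,k). measure lborel k *\<^sub>R P (f x)) p - integral {a..b} (\<lambda>s. P (f s))) < e"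
      using \<open>e > 0\<close> unfolding has_integral_real by metis
    obtain p where p: "p tagged_division_of {a..b}" "(\<lambda>x. d x \<inter> d' x) fine p"
      using fine_division_exists_real[OF gauge_Int[OF d]] by blast
    have fin: "finite p" using p by (auto intro: tagged_division_of_finite)
    have inS: "f x \<in> S" if "(x, k) \<in> p" for x k
      using f(2) tag_in_interval[of p "{a..b}" x k] p(1) that by auto
    have *: "sum (\<lambda>(x,k). measure lborel k *\<^sub>R f x) p \<in> S \<and>
        P (sum (\<lambda>(x,k). measure lborel k *\<^sub>R f x) p) = (\<Sum>z\<in>p. P ((\<lambda>(x,k). measure lborel k *\<^sub>R f x) z))"
      by (rule Psum[OF fin]) (auto intro!: subspace_scale[OF S] inS)
    also have "(\<Sum>z\<in>p. P ((\<lambda>(x,k). measure lborel k *\<^sub>R f x) z)) = sum (\<lambda>(x,k). measure lborel k *\<^sub>R P (f x)) p"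
      by (rule sum.cong) (auto simp: scale inS)
    finally show ?thesis
      using D[of p] D'[of p] p by (intro bexI[of _ "sum (\<lambda>(x,k). measure lborel k *\<^sub>R f x) p"]) (auto simp: fine_Int)
  qed
  show I: "integral {a..b} f \<in> S"
    using approx \<open>closed S\<close> closure_approachable[of "integral {a..b} f" S] by (auto simp: dist_norm)
  have "norm (P (integral {a..b} f) - integral {a..b} (\<lambda>s. P (f s))) \<le> 0 + e" if "e > 0" for e
  proof -
    \<comment> \<open>Replacing the integral by the Riemann sum \<open>y\<close> under
      \<open>P\<close> costs \<open>\<bar>K\<bar> * e'\<close>, and the Riemann sum of
      \<open>P \<circ> f\<close> costs \<open>e'\<close>.\<close>
    define e' where "e' = e / (\<bar>K\<bar> + 1)"
    have e': "e' > 0" using that by (simp add: e'_def)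
    obtain y where y: "y \<in> S" "norm (y - integral {a..b} f) < e'"
      "norm (P y - integral {a..b} (\<lambda>s. P (f s))) < e'" using approx[OF e'] by blast
    have eq: "P (integral {a..b} f) = P (integral {a..b} f - y) + P y"
      using add[OF subspace_diff[OF S I y(1)] y(1)] by simp
    have "norm (P (integral {a..b} f - y)) \<le> K * norm (integral {a..b} f - y)"
      by (rule K[OF subspace_diff[OF S I y(1)]])
    also have "\<dots> \<le> \<bar>K\<bar> * e'"
      using y(2) by (intro mult_mono) (auto simp: norm_minus_commute)
    finally have "norm (P (integral {a..b} f) - integral {a..b} (\<lambda>s. P (f s))) \<le> \<bar>K\<bar> * e' + e'"
      using y(3) norm_triangle_ineq[of "P (integral {a..b} f - y)" "P y - integral {a..b} (\<lambda>s. P (f s))"]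
      unfolding eq by (simp add: algebra_simps)
    also have "\<dots> = (\<bar>K\<bar> + 1) * e'" by (simp add: algebra_simps)
    also have "\<dots> = e" unfolding e'_def by (simp add: add_nonneg_eq_0_iff)
    finally show ?thesis by simp
  qed
  then have "norm (P (integral {a..b} f) - integral {a..b} (\<lambda>s. P (f s))) \<le> 0"
    by (rule field_le_epsilon)
  then show "P (integral {a..b} f) = integral {a..b} (\<lambda>s. P (f s))" by simp
qed

lemma integral_in_closed_subspace:
  fixes f :: "real \<Rightarrow> 'a::banach"
  assumes "subspace S" "closed S" "continuous_on {a..b} f" "f ` {a..b} \<subseteq> S"
  shows "integral {a..b} f \<in> S"
  using assms by (intro integral_bounded_linear_on(1)[of S "\<lambda>x. x"])
    (auto simp: bounded_linear_on_def linear_on_def intro!: exI[of _ 1])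

text \<open>The difference of the integrands is the derivative of \<open>(b - s)\<close> times the
  integral of \<open>f\<close> over \<open>{a..s}\<close>, which vanishes at both ends.\<close>

lemma integral_indefinite_eq:
  fixes f :: "real \<Rightarrow> 'a::banach"
  assumes "a \<le> b" "continuous_on {a..b} f"
  shows "integral {a..b} (\<lambda>r. integral {a..r} f) = integral {a..b} (\<lambda>s. (b - s) *\<^sub>R f s)"
proof -
  have "((\<lambda>s. (b - s) *\<^sub>R f s - integral {a..s} f) has_integral
      ((b - b) *\<^sub>R integral {a..b} f - (b - a) *\<^sub>R integral {a..a} f)) {a..b}"
    using assms
    by (intro fundamental_theorem_of_calculus)
      (auto intro!: derivative_eq_intros has_vector_derivative_scaleR integral_has_vector_derivative
        simp: has_real_derivative_iff_has_vector_derivative)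
  then have "integral {a..b} (\<lambda>s. (b - s) *\<^sub>R f s - integral {a..s} f) = 0"
    by (simp add: integral_unique)
  moreover have "integral {a..b} (\<lambda>s. (b - s) *\<^sub>R f s - integral {a..s} f) =
      integral {a..b} (\<lambda>s. (b - s) *\<^sub>R f s) - integral {a..b} (\<lambda>r. integral {a..r} f)"
    using assms by (intro integral_diff integrable_continuous_real continuous_intros
        indefinite_integral_continuous_1) auto
  ultimately show ?thesis by simp
qed

lemma continuous_on_compose_Pair_curried:
  assumes "continuous_on (S \<times> T) (\<lambda>(r, s). F r s)"
    and "continuous_on Q p" "continuous_on Q q" "p ` Q \<subseteq> S" "q ` Q \<subseteq> T"
  shows "continuous_on Q (\<lambda>x. F (p x) (q x))"
  using continuous_on_compose2[OF assms(1), of Q "\<lambda>x. (p x, q x)"] assms(2-)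
  by (fastforce intro: continuous_on_Pair)

text \<open>Subtracting the diagonal values makes the extension by zero across the diagonal continuous,
  so that the theorem on rectangles applies.\<close>

lemma integral_swap_triangle:
  fixes F :: "real \<Rightarrow> real \<Rightarrow> 'a::banach"
  assumes ab: "a \<le> b" and F: "continuous_on ({a..b} \<times> {a..b}) (\<lambda>(r, s). F r s)"
  shows "integral {a..b} (\<lambda>r. integral {a..r} (F r)) = integral {a..b} (\<lambda>s. integral {s..b} (\<lambda>r. F r s))"
proof -
  define G where "G r s = F (max r s) s - F s s" for r s
  note Fc = continuous_on_compose_Pair_curried[OF F]
  have G: "continuous_on ({a..b} \<times> {a..b}) (\<lambda>(r, s). G r s)"
    unfolding G_def case_prod_unfold
    by (intro continuous_intros Fc) auto
  have swap: "integral {a..b} (\<lambda>r. integral {a..b} (G r)) = integral {a..b} (\<lambda>s. integral {a..b} (\<lambda>r. G r s))"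
    using integral_swap_continuous[of a a b b G] G by (simp add: cbox_Pair_eq)
  have Gc: "continuous_on {a..b} (G r)" "continuous_on {a..b} (\<lambda>s. G s r)" if "r \<in> {a..b}" for r
    unfolding G_def using that by (auto intro!: continuous_intros Fc)
  have D: "continuous_on {a..b} (\<lambda>s. F s s)" by (intro Fc) auto
  have L: "integral {a..b} (G r) = integral {a..r} (F r) - integral {a..r} (\<lambda>s. F s s)"
    if r: "r \<in> {a..b}" for r
  proof -
    have "integral {a..b} (G r) = integral {a..r} (G r) + integral {r..b} (G r)"
      using r by (intro Henstock_Kurzweil_Integration.integral_combine[symmetric] integrable_continuous_real Gc) auto
    also have "integral {r..b} (G r) = integral {r..b} (\<lambda>_. 0)"
      by (rule integral_cong) (auto simp: G_def max_def)
    also have "integral {a..r} (G r) = integral {a..r} (\<lambda>s. F r s - F s s)"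
      by (rule integral_cong) (auto simp: G_def max_def)
    also have "\<dots> = integral {a..r} (F r) - integral {a..r} (\<lambda>s. F s s)"
      using r by (intro integral_diff integrable_continuous_real Fc) auto
    finally show ?thesis by simp
  qed
  have R: "integral {a..b} (\<lambda>r. G r s) = integral {s..b} (\<lambda>r. F r s) - (b - s) *\<^sub>R F s s"
    if s: "s \<in> {a..b}" for s
  proof -
    have "integral {a..b} (\<lambda>r. G r s) = integral {a..s} (\<lambda>r. G r s) + integral {s..b} (\<lambda>r. G r s)"
      using s by (intro Henstock_Kurzweil_Integration.integral_combine[symmetric] integrable_continuous_real Gc) auto
    also have "integral {a..s} (\<lambda>r. G r s) = integral {a..s} (\<lambda>_. 0)"
      by (rule integral_cong) (auto simp: G_def max_def)
    also have "integral {s..b} (\<lambda>r. G r s) = integral {s..b} (\<lambda>r. F r s - F s s)"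
      by (rule integral_cong) (auto simp: G_def max_def)
    also have "\<dots> = integral {s..b} (\<lambda>r. F r s) - integral {s..b} (\<lambda>r. F s s)"
      using s by (intro integral_diff integrable_continuous_real Fc) auto
    finally show ?thesis using s by simp
  qed
  have 1: "continuous_on {a..b} (\<lambda>r. integral {a..b} (G r))"
    using integral_continuous_on_param[of "{a..b}" a b G] G by simp
  have 2: "continuous_on {a..b} (\<lambda>s. integral {a..b} (\<lambda>r. G r s))"
    using integral_continuous_on_param[of "{a..b}" a b "\<lambda>s r. G r s"] continuous_on_swap_args[of "{a..b}" "{a..b}" G] G
    by simp
  have 3: "continuous_on {a..b} (\<lambda>r. integral {a..r} (\<lambda>s. F s s))"
    by (intro indefinite_integral_continuous_1 integrable_continuous_real D)
  have 4: "continuous_on {a..b} (\<lambda>s. (b - s) *\<^sub>R F s s)" by (intro continuous_intros D)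
  \<comment> \<open>The diagonal values subtracted in \<open>G\<close> return as an iterated
    integral on one side and with weight \<open>b - s\<close> on the other;
    \<open>integral_indefinite_eq\<close> identifies the two.\<close>
  have "integral {a..b} (\<lambda>r. integral {a..r} (F r)) =
      integral {a..b} (\<lambda>r. integral {a..b} (G r) + integral {a..r} (\<lambda>s. F s s))"
    by (rule integral_cong) (simp add: L)
  also have "\<dots> = integral {a..b} (\<lambda>s. integral {a..b} (\<lambda>r. G r s)) +
      integral {a..b} (\<lambda>s. (b - s) *\<^sub>R F s s)"
    using 1 3 integral_indefinite_eq[OF ab D] swap
    by (simp add: integral_add integrable_continuous_real)
  also have "\<dots> = integral {a..b} (\<lambda>s. integral {a..b} (\<lambda>r. G r s) + (b - s) *\<^sub>R F s s)"
    using 2 4 by (simp add: integral_add integrable_continuous_real)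
  also have "\<dots> = integral {a..b} (\<lambda>s. integral {s..b} (\<lambda>r. F r s))"
    by (rule integral_cong) (simp add: R)
  finally show ?thesis .
qed

text \<open>Extending \<open>F\<close> across the diagonal by its diagonal values makes the limits
  of integration fixed, so continuity in the parameter applies. The surplus over the other triangle
  involves only \<open>F s s\<close> and is visibly continuous.\<close>

lemma continuous_on_integral_triangle:
  fixes F :: "real \<Rightarrow> real \<Rightarrow> 'a::banach"
  assumes F: "continuous_on ({a..b} \<times> {a..b}) (\<lambda>(r, s). F r s)"
  shows "continuous_on {a..b} (\<lambda>r. integral {a..r} (F r))"
    "continuous_on {a..b} (\<lambda>s. integral {s..b} (\<lambda>r. F r s))"
proof -
  note Fc = continuous_on_compose_Pair_curried[OF F]
  have D: "continuous_on {a..b} (\<lambda>s. F s s)" by (intro Fc) auto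
  have p1: "continuous_on {a..b} (\<lambda>r. integral {a..b} (\<lambda>s. F (max r s) s))"
    by (rule integral_continuous_on_param[of "{a..b}" a b "\<lambda>r s. F (max r s) s", unfolded box_real])
      (auto simp: case_prod_unfold intro!: Fc continuous_intros)
  have p2: "continuous_on {a..b} (\<lambda>s. integral {a..b} (\<lambda>r. F (max r s) s))"
    by (rule integral_continuous_on_param[of "{a..b}" a b "\<lambda>s r. F (max r s) s", unfolded box_real])
      (auto simp: case_prod_unfold intro!: Fc continuous_intros)
  have "continuous_on {a..b} (\<lambda>r. integral {a..b} (\<lambda>s. F (max r s) s) - integral {r..b} (\<lambda>s. F s s))"
    by (intro continuous_intros indefinite_integral_continuous_1' integrable_continuous_real D p1)
  moreover have "integral {a..b} (\<lambda>s. F (max r s) s) - integral {r..b} (\<lambda>s. F s s) = integral {a..r} (F r)"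
    if r: "r \<in> {a..b}" for r
  proof -
    have "integral {a..b} (\<lambda>s. F (max r s) s) =
        integral {a..r} (\<lambda>s. F (max r s) s) + integral {r..b} (\<lambda>s. F (max r s) s)"
      using r by (intro Henstock_Kurzweil_Integration.integral_combine[symmetric] integrable_continuous_real Fc continuous_intros) auto
    moreover have "integral {a..r} (\<lambda>s. F (max r s) s) = integral {a..r} (F r)"
      by (rule integral_cong) (auto simp: max_def)
    moreover have "integral {r..b} (\<lambda>s. F (max r s) s) = integral {r..b} (\<lambda>s. F s s)"
      by (rule integral_cong) (auto simp: max_def)
    ultimately show ?thesis by simp
  qed
  ultimately show "continuous_on {a..b} (\<lambda>r. integral {a..r} (F r))"
    by (rule continuous_on_eq)
  have "continuous_on {a..b} (\<lambda>s. integral {a..b} (\<lambda>r. F (max r s) s) - (s - a) *\<^sub>R F s s)"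
    by (intro continuous_intros D p2)
  moreover have "integral {a..b} (\<lambda>r. F (max r s) s) - (s - a) *\<^sub>R F s s = integral {s..b} (\<lambda>r. F r s)"
    if s: "s \<in> {a..b}" for s
  proof -
    have "integral {a..b} (\<lambda>r. F (max r s) s) =
        integral {a..s} (\<lambda>r. F (max r s) s) + integral {s..b} (\<lambda>r. F (max r s) s)"
      using s by (intro Henstock_Kurzweil_Integration.integral_combine[symmetric] integrable_continuous_real Fc continuous_intros) auto
    moreover have "integral {a..s} (\<lambda>r. F (max r s) s) = integral {a..s} (\<lambda>r. F s s)"
      by (rule integral_cong) (auto simp: max_def)
    moreover have "integral {s..b} (\<lambda>r. F (max r s) s) = integral {s..b} (\<lambda>r. F r s)"
      by (rule integral_cong) (auto simp: max_def)
    ultimately show ?thesis using s by simp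
  qed
  ultimately show "continuous_on {a..b} (\<lambda>s. integral {s..b} (\<lambda>r. F r s))"
    by (rule continuous_on_eq)
qed

section \<open>The unperturbed problem\<close>

text \<open>A normal form of the two conditions: estimates are pointwise, \<open>k = 0\<close> is
  included, and \<omega> is nonnegative, so that \<open>exp (2 * \<omega> * t)\<close> is monotone
  in \<open>t\<close> and \<open>l > 2 * \<omega>\<close> implies
  \<open>l > \<omega>\<close>.\<close>

locale resolvent_forcing =
  fixes D :: "'a::banach set" and A :: "'a \<Rightarrow> 'a" and \<omega> M :: real and \<delta> :: "real \<Rightarrow> real"
  assumes linear_A: "linear_on D UNIV A"
    and omega_nonneg: "0 \<le> \<omega>" and M_ge_1: "1 \<le> M"
    and in_resolvent_set: "l > \<omega> \<Longrightarrow> l \<in> resolvent_set D A"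
    and norm_resolvent_power: "l > \<omega> \<Longrightarrow> x \<in> closure D \<Longrightarrow>
      norm ((resolvent D A l ^^ k) x) \<le> M / (l - \<omega>) ^ k * norm x"
    and resolvent_tendsto_0: "((\<lambda>l. resolvent D A l x) \<longlongrightarrow> 0) at_top"
    and delta_nonneg: "t \<ge> 0 \<Longrightarrow> 0 \<le> \<delta> t" and delta_mono: "mono_on {0..} \<delta>"
    and delta_tendsto_0: "(\<delta> \<longlongrightarrow> 0) (at_right 0)"
    and forcing: "\<tau> > 0 \<Longrightarrow> continuous_on {0..\<tau>} f \<Longrightarrow>
      \<exists>u. continuous_on {0..\<tau>} u \<and> u ` {0..\<tau>} \<subseteq> closure D \<and>
        (\<forall>t\<in>{0..\<tau>}. integral {0..t} u \<in> D \<and> u t = A (integral {0..t} u) + integral {0..t} f \<and>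
          norm (u t) \<le> \<delta> t * (SUP s\<in>{0..t}. norm (f s)))"
begin

section \<open>Resolvent calculus and closedness of the operator\<close>

abbreviation R :: "real \<Rightarrow> 'a \<Rightarrow> 'a" where "R \<equiv> resolvent D A"

lemma subspace_D: "subspace D"
  and A_add: "x \<in> D \<Longrightarrow> y \<in> D \<Longrightarrow> A (x + y) = A x + A y"
  and A_scale: "x \<in> D \<Longrightarrow> A (c *\<^sub>R x) = c *\<^sub>R A x"
  using linear_A by (auto simp: linear_on_def)

lemma A_0: "A 0 = 0"
  using A_scale[of 0 0] subspace_0[OF subspace_D] by simp

lemma A_diff: "x \<in> D \<Longrightarrow> y \<in> D \<Longrightarrow> A (x - y) = A x - A y"
  using A_add[of x "(-1) *\<^sub>R y"] A_scale[of y "-1"] subspace_scale[OF subspace_D, of y "-1"] by simp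

lemma D_X0: "x \<in> D \<Longrightarrow> x \<in> closure D"
  using closure_subset by blast

lemma subspace_X0: "subspace (closure D)"
  unfolding subspace_def
proof (intro conjI ballI allI)
  show "0 \<in> closure D" by (rule D_X0[OF subspace_0[OF subspace_D]])
next
  fix x y assume "x \<in> closure D" "y \<in> closure D"
  then obtain f g where f: "\<And>n. f n \<in> D" "f \<longlonglongrightarrow> x" and g: "\<And>n. g n \<in> D" "g \<longlonglongrightarrow> y"
    by (auto simp: closure_sequential)
  show "x + y \<in> closure D"
    unfolding closure_sequential
    by (intro exI[of _ "\<lambda>n. f n + g n"] conjI allI tendsto_add f g subspace_add[OF subspace_D])
next
  fix c x assume "x \<in> closure D"
  then obtain f where f: "\<And>n. f n \<in> D" "f \<longlonglongrightarrow> x"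
    by (auto simp: closure_sequential)
  show "c *\<^sub>R x \<in> closure D"
    unfolding closure_sequential
    by (intro exI[of _ "\<lambda>n. c *\<^sub>R f n"] conjI allI tendsto_scaleR tendsto_const f subspace_scale[OF subspace_D])
qed

lemma resolvent:
  assumes "l > \<omega>"
  shows resolvent_bounded_linear: "bounded_linear (R l)" and resolvent_in_D: "R l x \<in> D"
    and A_resolvent: "A (R l x) = l *\<^sub>R R l x - x"
    and resolvent_inverse: "y \<in> D \<Longrightarrow> R l (l *\<^sub>R y - A y) = y"
proof -
  have bij: "bij_betw (\<lambda>x. l *\<^sub>R x - A x) D UNIV" and "bounded_linear (R l)"
    using in_resolvent_set[OF assms] by (auto simp: resolvent_set_def)
  then show "bounded_linear (R l)" by simp
  show "R l x \<in> D"
    using bij the_inv_into_into[of "\<lambda>x. l *\<^sub>R x - A x" D x D] by (auto simp: resolvent_def bij_betw_def)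
  have "l *\<^sub>R R l x - A (R l x) = x"
    using bij f_the_inv_into_f_bij_betw[OF bij, of x] by (auto simp: resolvent_def)
  then show "A (R l x) = l *\<^sub>R R l x - x" by (simp add: algebra_simps)
  show "y \<in> D \<Longrightarrow> R l (l *\<^sub>R y - A y) = y"
    using bij the_inv_into_f_f[of "\<lambda>x. l *\<^sub>R x - A x" D y] by (auto simp: resolvent_def bij_betw_def)
qed

lemma resolvent_A:
  assumes "l > \<omega>" "y \<in> D"
  shows "R l (A y) = l *\<^sub>R R l y - y"
proof -
  interpret bounded_linear "R l" by (rule resolvent_bounded_linear[OF assms(1)])
  show ?thesis using resolvent_inverse[OF assms] by (simp add: diff scaleR algebra_simps)
qed

text \<open>Applying the continuous inverse \<open>R l\<close> to \<open>l x - A x\<close> recovers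
  \<open>x\<close>; in the limit \<open>x' = R l (l x' - y')\<close>, which gives both
  claims.\<close>

lemma A_closed:
  assumes F: "F \<noteq> bot" and x: "(x \<longlongrightarrow> x') F" and y: "((\<lambda>n. A (x n)) \<longlongrightarrow> y') F"
    and D: "\<forall>\<^sub>F n in F. x n \<in> D"
  shows "x' \<in> D" "A x' = y'"
proof -
  define l where "l = \<omega> + 1"
  have l: "l > \<omega>" by (simp add: l_def)
  have "((\<lambda>n. l *\<^sub>R x n - A (x n)) \<longlongrightarrow> l *\<^sub>R x' - y') F"
    by (intro tendsto_intros x y)
  from bounded_linear.tendsto[OF resolvent_bounded_linear[OF l] this]
  have "((\<lambda>n. R l (l *\<^sub>R x n - A (x n))) \<longlongrightarrow> R l (l *\<^sub>R x' - y')) F" .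
  then have "(x \<longlongrightarrow> R l (l *\<^sub>R x' - y')) F"
    by (rule Lim_transform_eventually) (use D in eventually_elim, simp add: resolvent_inverse[OF l])
  then have *: "x' = R l (l *\<^sub>R x' - y')"
    by (rule tendsto_unique[OF F x])
  show "x' \<in> D" using resolvent_in_D[OF l, of "l *\<^sub>R x' - y'"] unfolding *[symmetric] .
  show "A x' = y'" using A_resolvent[OF l, of "l *\<^sub>R x' - y'"] unfolding *[symmetric] by simp
qed

text \<open>Hille's theorem for a closed operator. Writing \<open>W\<close> as \<open>R l\<close> of
  the continuous function \<open>l W - A W\<close> lets a bounded operator, instead of
  \<open>A\<close>, pass through the integral.\<close>

lemma integral_A:
  fixes W :: "real \<Rightarrow> 'a"
  assumes W: "continuous_on {a..b} W" "\<And>s. s \<in> {a..b} \<Longrightarrow> W s \<in> D"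
    and AW: "continuous_on {a..b} (\<lambda>s. A (W s))"
  shows "integral {a..b} W \<in> D" "A (integral {a..b} W) = integral {a..b} (\<lambda>s. A (W s))"
proof -
  define l where "l = \<omega> + 1"
  have l: "l > \<omega>" by (simp add: l_def)
  have "integral {a..b} W = integral {a..b} (R l \<circ> (\<lambda>s. l *\<^sub>R W s - A (W s)))"
    by (rule integral_cong) (simp add: resolvent_inverse[OF l] W)
  also have "\<dots> = R l (integral {a..b} (\<lambda>s. l *\<^sub>R W s - A (W s)))"
    by (rule integral_linear[OF integrable_continuous_real resolvent_bounded_linear[OF l]])
      (intro continuous_intros W AW)
  also have "integral {a..b} (\<lambda>s. l *\<^sub>R W s - A (W s)) =
      l *\<^sub>R integral {a..b} W - integral {a..b} (\<lambda>s. A (W s))"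
    by (subst integral_diff) (auto intro!: integrable_continuous_real continuous_intros W AW)
  finally have *: "integral {a..b} W = R l (l *\<^sub>R integral {a..b} W - integral {a..b} (\<lambda>s. A (W s)))" .
  show "integral {a..b} W \<in> D"
    using resolvent_in_D[OF l, of "l *\<^sub>R integral {a..b} W - integral {a..b} (\<lambda>s. A (W s))"]
    unfolding *[symmetric] .
  show "A (integral {a..b} W) = integral {a..b} (\<lambda>s. A (W s))"
    using A_resolvent[OF l, of "l *\<^sub>R integral {a..b} W - integral {a..b} (\<lambda>s. A (W s))"]
    unfolding *[symmetric] by simp
qed

text \<open>Beyond \<open>2 * \<omega>\<close> the quotient \<open>l / (l - \<omega>)\<close> is at
  most 2. The resulting bound is independent of \<open>l\<close>, which the density and compactness
  arguments below rely on.\<close>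

lemma norm_scaled_resolvent:
  assumes "l > 2 * \<omega>" "x \<in> closure D"
  shows "norm (l *\<^sub>R R l x) \<le> 2 * M * norm x"
proof -
  have l: "l > \<omega>" "l > 0" using assms omega_nonneg by auto
  have "norm (R l x) \<le> M / (l - \<omega>) * norm x"
    using norm_resolvent_power[OF l(1) assms(2), of 1] by simp
  then have "norm (l *\<^sub>R R l x) \<le> (l / (l - \<omega>)) * (M * norm x)"
    using mult_left_mono[of _ _ l] l by (fastforce simp: mult_ac)
  also have "\<dots> \<le> 2 * (M * norm x)"
    using l assms M_ge_1 by (intro mult_right_mono) (auto simp: field_simps)
  finally show ?thesis by simp
qed

text \<open>For \<open>y\<close> in \<open>D\<close> the error is \<open>R l (A y)\<close>, which
  tends to zero by assumption. Density and the uniform bound \<open>2 * M\<close> do the rest, with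
  three errors \<open>2 * M * e'\<close>, \<open>e'\<close> and \<open>e'\<close>.\<close>

lemma scaled_resolvent_tendsto:
  assumes "x \<in> closure D"
  shows "((\<lambda>l. l *\<^sub>R R l x) \<longlongrightarrow> x) at_top"
  unfolding tendsto_iff
proof (intro allI impI)
  fix e :: real assume e: "e > 0"
  define e' where "e' = e / (2 * M + 2)"
  have e': "e' > 0" "(2 * M + 2) * e' = e" using e M_ge_1 by (auto simp: e'_def)
  obtain y where y: "y \<in> D" "norm (y - x) < e'"
    using assms e' by (auto simp: closure_approachable dist_norm)
  have "\<forall>\<^sub>F l in at_top. norm (R l (A y)) < e'"
    using tendstoD[OF resolvent_tendsto_0[of "A y"] e'(1)] by (simp add: dist_norm)
  then show "\<forall>\<^sub>F l in at_top. dist (l *\<^sub>R R l x) x < e"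
    using eventually_gt_at_top[of "2 * \<omega>"]
  proof eventually_elim
    case (elim l)
    have l: "l > \<omega>" using elim omega_nonneg by simp
    interpret bounded_linear "R l" by (rule resolvent_bounded_linear[OF l])
    have "l *\<^sub>R R l x - x = l *\<^sub>R R l (x - y) + R l (A y) + (y - x)"
      using resolvent_A[OF l y(1)] by (simp add: diff algebra_simps)
    also have "norm \<dots> \<le> norm (l *\<^sub>R R l (x - y)) + norm (R l (A y)) + norm (y - x)"
      by (rule norm_add3_le)
    also have "\<dots> < 2 * M * e' + e' + e'"
    proof -
      have "norm (l *\<^sub>R R l (x - y)) \<le> 2 * M * norm (x - y)"
        using elim y assms D_X0 by (intro norm_scaled_resolvent subspace_diff[OF subspace_X0]) auto
      also have "\<dots> \<le> 2 * M * e'"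
        using y(2) M_ge_1 by (intro mult_left_mono) (auto simp: norm_minus_commute)
      finally show ?thesis using elim(1) y(2) by simp
    qed
    finally show ?case using e'(2) by (simp add: dist_norm algebra_simps)
  qed
qed

text \<open>Pointwise convergence on a finite \<open>e'\<close>-net spreads to all of
  \<open>K\<close> because the operators share the Lipschitz constant \<open>2 * M\<close> on
  \<open>X\<^sub>0\<close>.\<close>

lemma scaled_resolvent_uniform_on_compact:
  assumes K: "compact K" "K \<subseteq> closure D" and e: "e > 0"
  shows "\<forall>\<^sub>F l in at_top. \<forall>x\<in>K. norm (l *\<^sub>R R l x - x) < e"
proof -
  define e' where "e' = e / (2 * M + 2)"
  have e': "e' > 0" "(2 * M + 2) * e' = e" using e M_ge_1 by (auto simp: e'_def)
  obtain N where N: "finite N" "N \<subseteq> K" "K \<subseteq> (\<Union>y\<in>N. ball y e')"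
    by (rule compactE_image[OF K(1), of K "\<lambda>y. ball y e'"]) (use e'(1) in auto)
  have "\<forall>\<^sub>F l in at_top. \<forall>y\<in>N. dist (l *\<^sub>R R l y) y < e'"
    using N K e' by (intro eventually_ball_finite ballI tendstoD[OF scaled_resolvent_tendsto]) auto
  then show ?thesis using eventually_gt_at_top[of "2 * \<omega>"]
  proof eventually_elim
    case (elim l)
    have l: "l > \<omega>" using elim omega_nonneg by simp
    interpret bounded_linear "R l" by (rule resolvent_bounded_linear[OF l])
    show ?case
    proof
      fix x assume x: "x \<in> K"
      then obtain y where y: "y \<in> N" "dist y x < e'" using N by auto
      have "l *\<^sub>R R l x - x = l *\<^sub>R R l (x - y) + (l *\<^sub>R R l y - y) + (y - x)"
        by (simp add: diff algebra_simps)
      also have "norm \<dots> \<le> norm (l *\<^sub>R R l (x - y)) + norm (l *\<^sub>R R l y - y) + norm (y - x)"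
        by (rule norm_add3_le)
      also have "\<dots> < 2 * M * e' + e' + e'"
      proof -
        have "norm (l *\<^sub>R R l (x - y)) \<le> 2 * M * norm (x - y)"
          using elim x y N K by (intro norm_scaled_resolvent subspace_diff[OF subspace_X0]) auto
        also have "\<dots> \<le> 2 * M * e'"
          using y(2) M_ge_1 by (intro mult_left_mono) (auto simp: dist_norm norm_minus_commute)
        finally show ?thesis using bspec[OF elim(1) y(1)] y(2) by (simp add: dist_norm)
      qed
      finally show "norm (l *\<^sub>R R l x - x) < e" using e'(2) by (simp add: algebra_simps)
    qed
  qed
qed

text \<open>The forcing \<open>g\<close> is arbitrary, so that \<open>B r (u r) + f r\<close> can be
  inserted and the perturbed problem becomes an instance. Continuity of \<open>g\<close> is included
  to make every integral below exist.\<close>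

definition sol :: "real \<Rightarrow> real \<Rightarrow> (real \<Rightarrow> 'a) \<Rightarrow> 'a \<Rightarrow> (real \<Rightarrow> 'a) \<Rightarrow> bool" where
  "sol a b g x u \<longleftrightarrow> continuous_on {a..b} g \<and> continuous_on {a..b} u \<and> u ` {a..b} \<subseteq> closure D \<and>
     (\<forall>t\<in>{a..b}. integral {a..t} u \<in> D \<and> u t = x + A (integral {a..t} u) + integral {a..t} g)"

lemma solD:
  assumes "sol a b g x u"
  shows "continuous_on {a..b} g" "continuous_on {a..b} u"
    "\<And>t. t \<in> {a..b} \<Longrightarrow> u t \<in> closure D" "\<And>t. t \<in> {a..b} \<Longrightarrow> integral {a..t} u \<in> D"
    "\<And>t. t \<in> {a..b} \<Longrightarrow> u t = x + A (integral {a..t} u) + integral {a..t} g"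
  using assms by (auto simp: sol_def)

lemma sol_integrable:
  assumes "sol a b g x u" "a \<le> c" "d \<le> b"
  shows "u integrable_on {c..d}" "g integrable_on {c..d}"
  using assms by (auto intro!: integrable_continuous_real continuous_on_subset[OF solD(1)[OF assms(1)]]
      continuous_on_subset[OF solD(2)[OF assms(1)]])

lemma sol_start: "sol a b g x u \<Longrightarrow> a \<le> b \<Longrightarrow> u a = x"
  using solD(5)[of a b g x u a] by (simp add: A_0)

lemma sol_cong:
  assumes "sol a b g x u" "\<And>t. t \<in> {a..b} \<Longrightarrow> u t = u' t" "\<And>t. t \<in> {a..b} \<Longrightarrow> g t = g' t"
  shows "sol a b g' x u'"
proof -
  have "integral {a..t} u' = integral {a..t} u" "integral {a..t} g' = integral {a..t} g" if "t \<in> {a..b}" for t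
    using that assms by (auto intro!: integral_cong)
  moreover have "continuous_on {a..b} g'" "continuous_on {a..b} u'"
    using continuous_on_eq[OF solD(1)[OF assms(1)] assms(3)] continuous_on_eq[OF solD(2)[OF assms(1)] assms(2)]
    by auto
  ultimately show ?thesis using assms(1,2) unfolding sol_def by auto
qed

section \<open>Restriction, superposition, gluing and limits of solutions\<close>

lemma sol_restrict: "sol a b g x u \<Longrightarrow> c \<le> b \<Longrightarrow> sol a c g x u"
  unfolding sol_def by (auto intro: continuous_on_subset)

lemma sol_add_scale:
  assumes u: "sol a b g x u" and v: "sol a b h y v"
  shows "sol a b (\<lambda>s. g s + c *\<^sub>R h s) (x + c *\<^sub>R y) (\<lambda>s. u s + c *\<^sub>R v s)"
proof -
  have "integral {a..t} (\<lambda>s. u s + c *\<^sub>R v s) = integral {a..t} u + c *\<^sub>R integral {a..t} v"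
    "integral {a..t} (\<lambda>s. g s + c *\<^sub>R h s) = integral {a..t} g + c *\<^sub>R integral {a..t} h" if "t \<in> {a..b}" for t
    using that sol_integrable[OF u, of a t] sol_integrable[OF v, of a t]
    by (auto simp: integral_add integrable_cmul)
  note I = this
  show ?thesis
    unfolding sol_def
  proof (intro conjI ballI)
    fix t assume t: "t \<in> {a..b}"
    note D = solD(4)[OF u t] solD(4)[OF v t]
    show "integral {a..t} (\<lambda>s. u s + c *\<^sub>R v s) \<in> D"
      by (simp add: I[OF t] D subspace_add[OF subspace_D] subspace_scale[OF subspace_D])
    show "u t + c *\<^sub>R v t = x + c *\<^sub>R y + A (integral {a..t} (\<lambda>s. u s + c *\<^sub>R v s)) +
        integral {a..t} (\<lambda>s. g s + c *\<^sub>R h s)"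
      by (subst solD(5)[OF u t], subst solD(5)[OF v t])
        (simp add: I[OF t] D A_add A_scale subspace_scale[OF subspace_D] algebra_simps)
  next
    show "(\<lambda>s. u s + c *\<^sub>R v s) ` {a..b} \<subseteq> closure D"
      using solD(3)[OF u] solD(3)[OF v]
      by (auto intro!: subspace_add[OF subspace_X0] subspace_scale[OF subspace_X0])
  qed (intro continuous_intros solD(1,2)[OF u] solD(1,2)[OF v])+
qed

lemma sol_diff:
  "sol a b g x u \<Longrightarrow> sol a b h y v \<Longrightarrow> sol a b (\<lambda>s. g s - h s) (x - y) (\<lambda>s. u s - v s)"
  using sol_add_scale[of a b g x u h y v "-1"] by simp

lemma sol_restart:
  assumes u: "sol a b g x u" and c: "a \<le> c" "c \<le> b"
  shows "sol c b g (u c) u"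
proof -
  have I: "integral {c..t} u = integral {a..t} u - integral {a..c} u"
    "integral {c..t} g = integral {a..t} g - integral {a..c} g" if "t \<in> {c..b}" for t
    using that c sol_integrable[OF u, of a t]
      Henstock_Kurzweil_Integration.integral_combine[of a c t u]
      Henstock_Kurzweil_Integration.integral_combine[of a c t g] by (auto simp: algebra_simps)
  have "integral {c..t} u \<in> D \<and> u t = u c + A (integral {c..t} u) + integral {c..t} g" if t: "t \<in> {c..b}" for t
  proof
    have D: "integral {a..t} u \<in> D" "integral {a..c} u \<in> D" using solD(4)[OF u] t c by auto
    then show "integral {c..t} u \<in> D" by (simp add: I[OF t] subspace_diff[OF subspace_D])
    show "u t = u c + A (integral {c..t} u) + integral {c..t} g"
      using solD(5)[OF u, of t] solD(5)[OF u, of c] t c by (simp add: I[OF t] A_diff D)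
  qed
  moreover have "continuous_on {c..b} g" "continuous_on {c..b} u" "u ` {c..b} \<subseteq> closure D"
    using solD(1-3)[OF u] c by (auto intro: continuous_on_subset)
  ultimately show ?thesis
    unfolding sol_def by blast
qed

lemma sol_concat:
  assumes u: "sol a c g x u" and w: "sol c b g (u c) w" and c: "a \<le> c" "c \<le> b"
  shows "sol a b g x (\<lambda>t. if t \<le> c then u t else w t)" (is "sol a b g x ?v")
proof -
  have wc: "w c = u c" by (rule sol_start[OF w c(2)])
  have cont: "continuous_on {a..b} (\<lambda>t. if t \<le> c then p t else q t)"
    if "continuous_on {a..c} p" "continuous_on {c..b} q" "p c = q c" for p q :: "real \<Rightarrow> 'a"
  proof -
    have "continuous_on ({a..c} \<union> {c..b}) (\<lambda>t. if t \<le> c then p t else q t)"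
      by (rule continuous_on_cases) (use that in auto)
    moreover have "{a..c} \<union> {c..b} = {a..b}" using c by auto
    ultimately show ?thesis by simp
  qed
  have v: "continuous_on {a..b} ?v" by (rule cont) (use solD[OF u] solD[OF w] wc in auto)
  have g: "continuous_on {a..b} g"
    using cont[of g g] solD(1)[OF u] solD(1)[OF w] by simp
  have "integral {a..t} ?v \<in> D \<and> ?v t = x + A (integral {a..t} ?v) + integral {a..t} g"
    if t: "t \<in> {a..b}" for t
  proof (cases "t \<le> c")
    case True
    then have "integral {a..t} ?v = integral {a..t} u" by (auto intro!: integral_cong)
    then show ?thesis using solD[OF u] True t by auto
  next
    case False
    have t': "t \<in> {c..b}" using False t by auto
    have "integral {a..t} ?v = integral {a..c} ?v + integral {c..t} ?v"
      using c False t by (intro Henstock_Kurzweil_Integration.integral_combine[symmetric]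
          integrable_continuous_real continuous_on_subset[OF v]) auto
    also have "integral {a..c} ?v = integral {a..c} u" by (auto intro!: integral_cong)
    also have "integral {c..t} ?v = integral {c..t} w" by (auto intro!: integral_cong simp: wc)
    finally have I: "integral {a..t} ?v = integral {a..c} u + integral {c..t} w" .
    have D: "integral {a..c} u \<in> D" "integral {c..t} w \<in> D"
      using solD(4)[OF u, of c] solD(4)[OF w t'] c by auto
    have G: "integral {a..t} g = integral {a..c} g + integral {c..t} g"
      using c False t by (intro Henstock_Kurzweil_Integration.integral_combine[symmetric]
          integrable_continuous_real continuous_on_subset[OF g]) auto
    show ?thesis
      using solD(5)[OF u, of c] solD(5)[OF w t'] D c False
      by (simp add: I A_add subspace_add[OF subspace_D] G)
  qed
  moreover have "?v ` {a..b} \<subseteq> closure D"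
    using solD(3)[OF u] solD(3)[OF w] by auto
  ultimately show ?thesis
    using v g unfolding sol_def by blast
qed

text \<open>The equations express \<open>A\<close> of the integrals through convergent quantities,
  so closedness of \<open>A\<close> carries both membership in \<open>D\<close> and the equation to
  the limit.\<close>

lemma sol_uniform_limit:
  assumes F: "F \<noteq> bot" and s: "\<And>n. sol a b (g n) (x n) (u n)"
    and u: "uniform_limit {a..b} u u' F" and g: "uniform_limit {a..b} g g' F" and x: "(x \<longlongrightarrow> x') F"
  shows "sol a b g' x' u'"
proof -
  have cont: "continuous_on {a..b} u'" "continuous_on {a..b} g'"
    using uniform_limit_theorem[OF _ u F] uniform_limit_theorem[OF _ g F] solD(1,2)[OF s] by auto
  have lim: "((\<lambda>n. u n t) \<longlongrightarrow> u' t) F" if "t \<in> {a..b}" for t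
    by (rule tendsto_uniform_limitI[OF u that])
  have "integral {a..t} u' \<in> D \<and> u' t = x' + A (integral {a..t} u') + integral {a..t} g'"
    if t: "t \<in> {a..b}" for t
  proof -
    have sub: "{a..t} \<subseteq> {a..b}" using t by auto
    have I: "((\<lambda>n. integral {a..t} (f n)) \<longlongrightarrow> integral {a..t} f') F"
      if f: "uniform_limit {a..b} f f' F" and c: "\<And>n. continuous_on {a..b} (f n)" for f and f' :: "real \<Rightarrow> 'a"
    proof -
      have cn: "\<And>n. continuous_on {a..t} (f n)" using c sub continuous_on_subset by blast
      obtain I J where "\<And>n. (f n has_integral I n) {a..t}" "(f' has_integral J) {a..t}" "(I \<longlongrightarrow> J) F"
        by (rule uniform_limit_integral[OF uniform_limit_on_subset[OF f sub] cn F]) auto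
      moreover have "(\<lambda>n. integral {a..t} (f n)) = I" "integral {a..t} f' = J"
        using calculation by (auto intro: integral_unique)
      ultimately show ?thesis by simp
    qed
    have Iu: "((\<lambda>n. integral {a..t} (u n)) \<longlongrightarrow> integral {a..t} u') F"
      by (rule I[OF u solD(2)[OF s]])
    have Ig: "((\<lambda>n. integral {a..t} (g n)) \<longlongrightarrow> integral {a..t} g') F"
      by (rule I[OF g solD(1)[OF s]])
    have "A (integral {a..t} (u n)) = u n t - x n - integral {a..t} (g n)" for n
      using solD(5)[OF s t] by (simp add: algebra_simps)
    then have IA: "((\<lambda>n. A (integral {a..t} (u n))) \<longlongrightarrow> u' t - x' - integral {a..t} g') F"
      by (auto intro!: tendsto_intros lim[OF t] x Ig)
    show ?thesis
      using A_closed[OF F Iu IA] solD(4)[OF s t] by simp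
  qed
  moreover have "u' t \<in> closure D" if t: "t \<in> {a..b}" for t
    by (rule Lim_in_closed_set[OF closed_closure _ F lim[OF t]]) (use solD(3)[OF s t] in auto)
  ultimately show ?thesis using cont unfolding sol_def by auto
qed

text \<open>On \<open>D\<close> the resolvent commutes with \<open>A\<close>: both products equal
  \<open>l R l y - y\<close>. This is the commutation behind the comparison of the two forcing
  terms.\<close>

lemma sol_resolvent:
  assumes u: "sol a b g x u" and l: "l > \<omega>"
  shows "sol a b (\<lambda>s. c *\<^sub>R R l (g s)) (c *\<^sub>R R l x) (\<lambda>s. c *\<^sub>R R l (u s))"
proof -
  interpret bounded_linear "R l" by (rule resolvent_bounded_linear[OF l])
  have I: "integral {a..t} (\<lambda>s. c *\<^sub>R R l (u s)) = c *\<^sub>R R l (integral {a..t} u)"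
    "integral {a..t} (\<lambda>s. c *\<^sub>R R l (g s)) = c *\<^sub>R R l (integral {a..t} g)" if "t \<in> {a..b}" for t
    using that sol_integrable[OF u, of a t] integral_linear[OF _ resolvent_bounded_linear[OF l], of _ "{a..t}"]
    by (simp_all add: o_def)
  have "c *\<^sub>R R l (u t) = c *\<^sub>R R l x + A (c *\<^sub>R R l (integral {a..t} u)) + c *\<^sub>R R l (integral {a..t} g)"
    if t: "t \<in> {a..b}" for t
    by (subst solD(5)[OF u t])
      (simp add: add A_scale resolvent_in_D[OF l] A_resolvent[OF l] resolvent_A[OF l solD(4)[OF u t]] algebra_simps)
  moreover have "c *\<^sub>R R l y \<in> D" for y
    by (intro subspace_scale[OF subspace_D] resolvent_in_D[OF l])
  moreover have "continuous_on {a..b} (\<lambda>s. c *\<^sub>R R l (g s))" "continuous_on {a..b} (\<lambda>s. c *\<^sub>R R l (u s))"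
    by (intro continuous_intros continuous_on solD(1,2)[OF u])+
  ultimately show ?thesis
    unfolding sol_def by (intro conjI ballI) (simp_all only: I image_subset_iff D_X0, auto)
qed

text \<open>Stability of the implicit Euler scheme, whose steps are powers of the scaled resolvent,
  bounds the regularized solution \<open>R \<mu> u\<close>, which is a classical one.\<close>

lemma resolvent_homogeneous_bound:
  assumes u: "sol a b (\<lambda>_. 0) x u" and \<mu>: "\<mu> > \<omega>" and t: "t \<in> {a..b}"
  shows "norm (R \<mu> (u t)) \<le> M * exp (2 * \<omega> * (t - a)) * norm (R \<mu> x)"
proof (cases "t = a")
  case True
  then show ?thesis using t sol_start[OF u] M_ge_1 by (auto simp: mult_le_cancel_right1)
next
  case False
  then have at: "a < t" using t by auto
  interpret B: bounded_linear "R \<mu>" by (rule resolvent_bounded_linear[OF \<mu>])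
  define y where "y s = R \<mu> (u s)" for s
  \<comment> \<open>This is \<open>A (y s)\<close> written without \<open>A\<close>, hence visibly
    continuous. The fact \<open>yint\<close> then says that \<open>y\<close> is continuously
    differentiable with derivative \<open>A y\<close>.\<close>
  define k where "k s = \<mu> *\<^sub>R y s - u s" for s
  have yD: "y s \<in> D" and Ay: "A (y s) = k s" for s
    by (simp_all add: y_def k_def resolvent_in_D[OF \<mu>] A_resolvent[OF \<mu>])
  have cu: "continuous_on {a..t} u" using solD(2)[OF u] t by (auto intro: continuous_on_subset)
  have cy: "continuous_on {a..t} y" unfolding y_def by (intro B.continuous_on cu)
  have ck: "continuous_on {a..t} k" unfolding k_def by (intro continuous_intros cy cu)
  have kX0: "k s \<in> closure D" if "s \<in> {a..t}" for s
    unfolding k_def using that t solD(3)[OF u, of s]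
    by (auto intro!: subspace_diff[OF subspace_X0] subspace_scale[OF subspace_X0] D_X0[OF yD])
  have yint: "y s = y a + integral {a..s} k" if s: "s \<in> {a..t}" for s
  proof -
    have sb: "s \<in> {a..b}" using s t by auto
    have cs: "continuous_on {a..s} u" "continuous_on {a..s} y"
      using s cu cy by (auto intro: continuous_on_subset)
    have iy: "integral {a..s} y = R \<mu> (integral {a..s} u)"
      using integral_linear[OF integrable_continuous_real[OF cs(1)] resolvent_bounded_linear[OF \<mu>]]
      by (simp add: o_def y_def[abs_def])
    have "integral {a..s} k = \<mu> *\<^sub>R integral {a..s} y - integral {a..s} u"
      unfolding k_def using cs
      by (subst integral_diff) (auto intro!: integrable_continuous_real continuous_intros)
    also have "\<dots> = R \<mu> (A (integral {a..s} u))"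
      by (simp add: iy resolvent_A[OF \<mu> solD(4)[OF u sb]])
    also have "\<dots> = y s - y a"
      using solD(5)[OF u sb] sol_start[OF u] t by (simp add: y_def flip: B.diff)
    finally show ?thesis by simp
  qed
  have "norm (y t) \<le> M * exp (2 * \<omega> * (t - a)) * norm (y a) + e" if e0: "e > 0" for e
  proof -
    \<comment> \<open>The defects of all steps add up to at most \<open>(t - a) * e'\<close> before
      amplification by \<open>M * exp (2 * \<omega> * (t - a))\<close>.\<close>
    define e' where "e' = e / (M * exp (2 * \<omega> * (t - a)) * (t - a))"
    have e': "e' > 0" "M * exp (2 * \<omega> * (t - a)) * ((t - a) * e') = e"
      using e0 M_ge_1 at by (auto simp: e'_def)
    have "uniformly_continuous_on {a..t} k"
      by (rule compact_uniformly_continuous[OF ck compact_Icc])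
    then obtain d where d: "d > 0" "\<And>s s'. s \<in> {a..t} \<Longrightarrow> s' \<in> {a..t} \<Longrightarrow> dist s' s < d \<Longrightarrow> dist (k s') (k s) < e'"
      using e' unfolding uniformly_continuous_on_def by metis
    \<comment> \<open>Enough steps for the step size \<open>h\<close> to lie below the modulus
      \<open>d\<close> and to satisfy \<open>h * \<omega> \<le> 1 / 2\<close>; the added 1 makes
      \<open>n\<close> positive and the comparison with \<open>d\<close> strict.\<close>
    define n where "n = nat \<lceil>max ((t - a) / d) (2 * \<omega> * (t - a))\<rceil> + 1"
    have n: "n \<ge> 1" "(t - a) / d < real n" "2 * \<omega> * (t - a) \<le> real n"
      unfolding n_def by linarith+
    define h where "h = (t - a) / n"
    have h: "h > 0" "h < d" "h * \<omega> \<le> 1 / 2" "n * h = t - a"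
      using n at d(1) by (auto simp: h_def field_simps)
    define l where "l = 1 / h"
    have l: "l > \<omega>" "l > 0" using h by (auto simp: l_def field_simps)
    interpret L: bounded_linear "R l" by (rule resolvent_bounded_linear[OF l(1)])
    define J where "J z = l *\<^sub>R R l z" for z
    interpret J: bounded_linear J unfolding J_def
      by (intro bounded_linear_scaleR_right[THEN bounded_linear_compose] resolvent_bounded_linear l)
    \<comment> \<open>The growth factor of one Euler step in the resolvent estimate. The restriction
      on \<open>h * \<omega>\<close> gives \<open>q \<le> exp (2 * (h * \<omega>))\<close>, whence
      the factor 2 in the exponent.\<close>
    define q where "q = 1 / (1 - h * \<omega>)"
    have q: "q \<ge> 1" "q \<le> exp (2 * (h * \<omega>))" "q = l / (l - \<omega>)"
    proof -
      have ho: "h * \<omega> \<ge> 0" using h omega_nonneg by simp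
      then show "q \<ge> 1" using h by (simp add: q_def)
      have "- (h * \<omega>) - 2 * (h * \<omega>)\<^sup>2 \<le> ln (1 - h * \<omega>)"
        by (rule ln_one_minus_pos_lower_bound) (use ho h in auto)
      moreover have "2 * (h * \<omega>)\<^sup>2 \<le> h * \<omega>"
        using mult_right_mono[OF h(3) ho] by (simp add: power2_eq_square)
      ultimately have "- (2 * (h * \<omega>)) \<le> ln (1 - h * \<omega>)" by simp
      then have "exp (- (2 * (h * \<omega>))) \<le> 1 - h * \<omega>" using h by (simp add: ln_ge_iff)
      then show "q \<le> exp (2 * (h * \<omega>))" using h by (simp add: q_def exp_minus field_simps)
      show "q = l / (l - \<omega>)" using h l by (simp add: q_def l_def field_simps)
    qed
    have Jpow_eq: "(J ^^ j) z = l ^ j *\<^sub>R (R l ^^ j) z" for j z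
      by (induction j) (auto simp: J_def L.scaleR)
    have Jpow: "norm ((J ^^ j) z) \<le> M * q ^ j * norm z" if "z \<in> closure D" for j z
    proof -
      have "norm ((J ^^ j) z) \<le> l ^ j * (M / (l - \<omega>) ^ j * norm z)"
        using mult_left_mono[OF norm_resolvent_power[OF l(1) that, of j], of "l ^ j"] l by (simp add: Jpow_eq)
      also have "\<dots> = M * q ^ j * norm z" by (simp add: q(3) power_divide)
      finally show ?thesis .
    qed
    define s where "s i = a + real i * h" for i :: nat
    have s_in: "s i \<in> {a..t}" if "i \<le> n" for i
    proof -
      have "real i * h \<le> real n * h" using that h by (intro mult_right_mono) auto
      then show ?thesis using h by (auto simp: s_def)
    qed
    \<comment> \<open>\<open>J\<close> is the inverse of \<open>I - h A\<close>, so the exact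
      solution is an Euler step applied to its previous value plus a defect. The defect is the
      integral of \<open>k r - k (s (Suc i))\<close>, controlled by uniform continuity.\<close>
    have step: "y (s (Suc i)) = J (y (s i) + (y (s (Suc i)) - h *\<^sub>R k (s (Suc i)) - y (s i)))"
      and err: "norm (y (s (Suc i)) - h *\<^sub>R k (s (Suc i)) - y (s i)) \<le> e' * h" if i: "i < n" for i
    proof -
      have "J (y (s (Suc i)) - h *\<^sub>R k (s (Suc i))) = R l (l *\<^sub>R y (s (Suc i)) - k (s (Suc i)))"
        using h by (simp add: J_def L.diff L.scaleR scaleR_diff_right) (simp add: l_def)
      also have "\<dots> = y (s (Suc i))"
        using resolvent_inverse[OF l(1) yD] by (simp add: Ay)
      finally show "y (s (Suc i)) = J (y (s i) + (y (s (Suc i)) - h *\<^sub>R k (s (Suc i)) - y (s i)))" by simp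
      have si: "s i \<in> {a..t}" "s (Suc i) \<in> {a..t}" "s (Suc i) = s i + h"
        using s_in[of i] s_in[of "Suc i"] i by (simp_all, simp add: s_def algebra_simps)
      have sub: "{s i..s (Suc i)} \<subseteq> {a..t}" using si by auto
      have "integral {a..s i} k + integral {s i..s (Suc i)} k = integral {a..s (Suc i)} k"
        using si h by (intro Henstock_Kurzweil_Integration.integral_combine
            integrable_continuous_real continuous_on_subset[OF ck]) auto
      then have "y (s (Suc i)) - h *\<^sub>R k (s (Suc i)) - y (s i) =
          integral {s i..s (Suc i)} k - integral {s i..s (Suc i)} (\<lambda>_. k (s (Suc i)))"
        using yint[OF si(1)] yint[OF si(2)] h si(3) by (simp add: algebra_simps)
      also have "\<dots> = integral {s i..s (Suc i)} (\<lambda>r. k r - k (s (Suc i)))"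
        by (rule integral_diff[symmetric])
          (auto intro!: integrable_continuous_real continuous_on_subset[OF ck sub])
      also have "norm \<dots> \<le> e' * (s (Suc i) - s i)"
      proof (rule integral_bound)
        show "s i \<le> s (Suc i)" using h si by simp
        show "continuous_on {s i..s (Suc i)} (\<lambda>r. k r - k (s (Suc i)))"
          by (intro continuous_intros continuous_on_subset[OF ck sub])
        fix r assume r: "r \<in> {s i..s (Suc i)}"
        have "dist r (s (Suc i)) < d" using r h si(3) by (auto simp: dist_real_def)
        then show "norm (k r - k (s (Suc i))) \<le> e'"
          using d(2)[OF si(2), of r] r sub by (auto simp: dist_norm)
      qed
      finally show "norm (y (s (Suc i)) - h *\<^sub>R k (s (Suc i)) - y (s i)) \<le> e' * h" using si by simp
    qed
    \<comment> \<open>Carrying an arbitrary power \<open>J ^^ j\<close> through the induction lets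
      each defect be estimated once by the bound for powers. Estimating step by step would multiply
      a factor \<open>M\<close> for every step.\<close>
    have bound: "norm ((J ^^ j) (y (s i))) \<le> M * q ^ (i + j) * (norm (y a) + i * (h * e'))" if "i \<le> n" for i j
      using that
    proof (induction i arbitrary: j)
      case 0
      then show ?case using Jpow[OF D_X0[OF yD], of j a] by (simp add: s_def)
    next
      case (Suc i)
      define \<epsilon> where "\<epsilon> = y (s (Suc i)) - h *\<^sub>R k (s (Suc i)) - y (s i)"
      have i: "i < n" using Suc by simp
      have \<epsilon>X0: "\<epsilon> \<in> closure D" unfolding \<epsilon>_def using s_in[of "Suc i"] Suc
        by (intro subspace_diff[OF subspace_X0] subspace_scale[OF subspace_X0] D_X0[OF yD] kX0) auto
      have Jlin: "(J ^^ j) (v + w) = (J ^^ j) v + (J ^^ j) w" for j v w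
        by (induction j) (auto simp: J.add)
      have "(J ^^ j) (y (s (Suc i))) = (J ^^ j) (J (y (s i) + \<epsilon>))"
        using step[OF i] by (simp add: \<epsilon>_def)
      also have "\<dots> = (J ^^ Suc j) (y (s i)) + (J ^^ Suc j) \<epsilon>"
        by (simp add: J.add Jlin funpow_swap1)
      also have "norm \<dots> \<le> M * q ^ (i + Suc j) * (norm (y a) + i * (h * e')) + M * q ^ Suc j * (h * e')"
      proof (intro order_trans[OF norm_triangle_ineq] add_mono)
        show "norm ((J ^^ Suc j) (y (s i))) \<le> M * q ^ (i + Suc j) * (norm (y a) + i * (h * e'))"
          by (rule Suc.IH) (use Suc in simp)
        have "norm ((J ^^ Suc j) \<epsilon>) \<le> M * q ^ Suc j * norm \<epsilon>" by (rule Jpow[OF \<epsilon>X0])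
        also have "\<dots> \<le> M * q ^ Suc j * (h * e')"
          using err[OF i] M_ge_1 q(1) by (intro mult_left_mono) (auto simp: \<epsilon>_def mult.commute)
        finally show "norm ((J ^^ Suc j) \<epsilon>) \<le> M * q ^ Suc j * (h * e')" .
      qed
      also have "\<dots> \<le> M * q ^ (i + Suc j) * (norm (y a) + i * (h * e')) + M * q ^ (i + Suc j) * (h * e')"
        using M_ge_1 q(1) h e' by (intro add_left_mono mult_right_mono mult_left_mono power_increasing) auto
      also have "\<dots> = M * q ^ (Suc i + j) * (norm (y a) + Suc i * (h * e'))"
        by (simp add: algebra_simps)
      finally show ?case .
    qed
    have qn: "q ^ n \<le> exp (2 * \<omega> * (t - a))"
    proof -
      have "q ^ n \<le> exp (2 * (h * \<omega>)) ^ n" using q by (intro power_mono) auto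
      also have "\<dots> = exp (real n * (2 * (h * \<omega>)))" by (rule exp_of_nat_mult[symmetric])
      also have "real n * (2 * (h * \<omega>)) = 2 * \<omega> * (real n * h)" by simp
      finally show ?thesis using h(4) by simp
    qed
    have "s n = t" using h(4) by (simp add: s_def)
    then have "norm (y t) \<le> M * q ^ n * (norm (y a) + (t - a) * e')"
      using bound[of n 0] h(4) by (simp add: mult.assoc[symmetric])
    also have "\<dots> \<le> M * exp (2 * \<omega> * (t - a)) * (norm (y a) + (t - a) * e')"
      using qn M_ge_1 at e' by (intro mult_right_mono mult_left_mono) auto
    also have "\<dots> = M * exp (2 * \<omega> * (t - a)) * norm (y a) + e"
      using e'(2) by (simp add: distrib_left)
    finally show ?thesis .
  qed
  then have "norm (y t) \<le> M * exp (2 * \<omega> * (t - a)) * norm (y a)"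
    by (rule field_le_epsilon)
  then show ?thesis using sol_start[OF u] t by (simp add: y_def)
qed

text \<open>The constant in the bound for \<open>R l (u t)\<close> does not depend on
  \<open>l\<close>; multiplying by \<open>l\<close> and letting it tend to infinity removes the
  regularization, since both \<open>u t\<close> and \<open>x\<close> lie in
  \<open>X\<^sub>0\<close>.\<close>

lemma homogeneous_bound:
  assumes u: "sol a b (\<lambda>_. 0) x u" and t: "t \<in> {a..b}"
  shows "norm (u t) \<le> M * exp (2 * \<omega> * (t - a)) * norm x"
proof (rule tendsto_le)
  have "x \<in> closure D" using sol_start[OF u] solD(3)[OF u, of a] t by auto
  then show "((\<lambda>l. M * exp (2 * \<omega> * (t - a)) * norm (l *\<^sub>R R l x)) \<longlongrightarrow>
      M * exp (2 * \<omega> * (t - a)) * norm x) at_top"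
    by (intro tendsto_intros scaled_resolvent_tendsto)
  show "((\<lambda>l. norm (l *\<^sub>R R l (u t))) \<longlongrightarrow> norm (u t)) at_top"
    by (intro tendsto_intros scaled_resolvent_tendsto solD(3)[OF u t])
  show "\<forall>\<^sub>F l in at_top. norm (l *\<^sub>R R l (u t)) \<le> M * exp (2 * \<omega> * (t - a)) * norm (l *\<^sub>R R l x)"
    using eventually_gt_at_top[of \<omega>]
  proof eventually_elim
    case (elim l)
    have "\<bar>l\<bar> * norm (R l (u t)) \<le> \<bar>l\<bar> * (M * exp (2 * \<omega> * (t - a)) * norm (R l x))"
      by (intro mult_left_mono resolvent_homogeneous_bound[OF u elim t]) auto
    then show ?case by (simp add: mult_ac)
  qed
qed simp

section \<open>Existence, uniqueness and a priori bounds\<close>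

lemma forcing_solution:
  assumes ab: "a \<le> b" and g: "continuous_on {a..b} g"
  obtains u where "sol a b g 0 u"
    "\<And>t G. t \<in> {a..b} \<Longrightarrow> (\<And>s. s \<in> {a..t} \<Longrightarrow> norm (g s) \<le> G) \<Longrightarrow> norm (u t) \<le> \<delta> (t - a) * G"
proof (cases "a = b")
  case True
  \<comment> \<open>The forcing condition speaks of positive lengths only, so the one-point interval
    is treated by hand.\<close>
  have "sol a b g 0 (\<lambda>_. 0)"
    unfolding sol_def using g True by (auto simp: A_0 subspace_0[OF subspace_D] subspace_0[OF subspace_X0])
  moreover have "norm (0::'a) \<le> \<delta> (t - a) * G"
    if "t \<in> {a..b}" "\<And>s. s \<in> {a..t} \<Longrightarrow> norm (g s) \<le> G" for t G
    using that(1) order_trans[OF norm_ge_zero that(2)[of t]] by (auto intro!: mult_nonneg_nonneg delta_nonneg)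
  ultimately show ?thesis by (rule that)
next
  case False
  then have "b - a > 0" using ab by simp
  moreover have "continuous_on {0..b - a} (\<lambda>s. g (s + a))"
    by (intro continuous_on_compose2[OF g] continuous_intros) auto
  ultimately obtain u where u: "continuous_on {0..b - a} u" "u ` {0..b - a} \<subseteq> closure D"
    and eq: "\<And>t. t \<in> {0..b - a} \<Longrightarrow> integral {0..t} u \<in> D \<and>
      u t = A (integral {0..t} u) + integral {0..t} (\<lambda>s. g (s + a)) \<and>
      norm (u t) \<le> \<delta> t * (SUP s\<in>{0..t}. norm (g (s + a)))"
    using forcing[of "b - a" "\<lambda>s. g (s + a)"] by blast
  have I: "integral {a..t} (\<lambda>s. u (s - a)) = integral {0..t - a} u"
    "integral {a..t} g = integral {0..t - a} (\<lambda>s. g (s + a))" for t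
    using integral_shift_real_ivl[of a a t "\<lambda>s. u (s - a)"] integral_shift_real_ivl[of a a t g] by simp_all
  have "sol a b g 0 (\<lambda>t. u (t - a))"
    unfolding sol_def
  proof (intro conjI ballI)
    show "continuous_on {a..b} (\<lambda>t. u (t - a))"
      by (intro continuous_on_compose2[OF u(1)] continuous_intros) auto
    show "(\<lambda>t. u (t - a)) ` {a..b} \<subseteq> closure D" using u(2) by auto
    fix t assume "t \<in> {a..b}"
    then have "t - a \<in> {0..b - a}" by auto
    from eq[OF this] show "integral {a..t} (\<lambda>t. u (t - a)) \<in> D"
      "u (t - a) = 0 + A (integral {a..t} (\<lambda>t. u (t - a))) + integral {a..t} g"
      unfolding I by simp_all
  qed (rule g)
  moreover have "norm (u (t - a)) \<le> \<delta> (t - a) * G"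
    if t: "t \<in> {a..b}" and G: "\<And>s. s \<in> {a..t} \<Longrightarrow> norm (g s) \<le> G" for t G
  proof -
    have "norm (u (t - a)) \<le> \<delta> (t - a) * (SUP s\<in>{0..t - a}. norm (g (s + a)))"
      using eq[of "t - a"] t by auto
    also have "\<dots> \<le> \<delta> (t - a) * G"
      using t by (intro mult_left_mono delta_nonneg cSUP_least) (auto intro!: G)
    finally show ?thesis .
  qed
  ultimately show ?thesis by (rule that)
qed

lemma sol_unique:
  assumes "sol a b g x u" "sol a b g x v" "t \<in> {a..b}"
  shows "u t = v t"
  using homogeneous_bound[of a b 0 "\<lambda>t. u t - v t" t] sol_diff[OF assms(1,2)] assms(3) by simp

lemma sol_exists_D:
  assumes ab: "a \<le> b" and x: "x \<in> D"
  shows "\<exists>u. sol a b (\<lambda>_. 0) x u"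
proof -
  obtain w where w: "sol a b (\<lambda>_. A x) 0 w"
    by (rule forcing_solution[OF ab, of "\<lambda>_. A x"]) auto
  have "sol a b (\<lambda>_. 0) x (\<lambda>t. x + w t)"
    unfolding sol_def
  proof (intro conjI ballI)
    show "continuous_on {a..b} (\<lambda>t. x + w t)" by (intro continuous_intros solD(2)[OF w])
    show "(\<lambda>t. x + w t) ` {a..b} \<subseteq> closure D"
      using solD(3)[OF w] by (auto intro!: subspace_add[OF subspace_X0] D_X0[OF x])
    fix t assume t: "t \<in> {a..b}"
    have I: "integral {a..t} (\<lambda>t. x + w t) = (t - a) *\<^sub>R x + integral {a..t} w"
      using t by (subst integral_add) (auto intro: sol_integrable[OF w])
    show "integral {a..t} (\<lambda>t. x + w t) \<in> D"
      unfolding I by (intro subspace_add[OF subspace_D] subspace_scale[OF subspace_D] x solD(4)[OF w t])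
    show "x + w t = x + A (integral {a..t} (\<lambda>t. x + w t)) + integral {a..t} (\<lambda>_. 0)"
      using solD(5)[OF w t] t
      by (simp add: I A_add A_scale x subspace_scale[OF subspace_D] solD(4)[OF w t] add.commute)
  qed simp
  then show ?thesis by (intro exI)
qed

lemma homogeneous_bound_uniform:
  assumes "sol a b (\<lambda>_. 0) x u" "t \<in> {a..b}"
  shows "norm (u t) \<le> M * exp (2 * \<omega> * (b - a)) * norm x"
proof -
  have "2 * \<omega> * (t - a) \<le> 2 * \<omega> * (b - a)" using assms(2) omega_nonneg by (intro mult_left_mono) auto
  then have "M * exp (2 * \<omega> * (t - a)) * norm x \<le> M * exp (2 * \<omega> * (b - a)) * norm x"
    using M_ge_1 by (intro mult_right_mono mult_left_mono) auto
  then show ?thesis using homogeneous_bound[OF assms] by simp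
qed

lemma sol_exists_homogeneous:
  assumes ab: "a \<le> b" and x: "x \<in> closure D"
  shows "\<exists>u. sol a b (\<lambda>_. 0) x u"
proof -
  obtain X where X: "\<And>n. X n \<in> D" "X \<longlonglongrightarrow> x" using x by (auto simp: closure_sequential)
  obtain u where u: "\<And>n. sol a b (\<lambda>_. 0) (X n) (u n)"
    using sol_exists_D[OF ab X(1)] by metis
  define K where "K = M * exp (2 * \<omega> * (b - a))"
  have K: "K > 0" using M_ge_1 by (simp add: K_def)
  have "uniformly_Cauchy_on {a..b} u"
    unfolding uniformly_Cauchy_on_def
  proof (intro allI impI)
    fix e :: real assume "e > 0"
    then have "e / K > 0" using K by simp
    then obtain N where N: "\<And>m n. m \<ge> N \<Longrightarrow> n \<ge> N \<Longrightarrow> dist (X m) (X n) < e / K"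
      using LIMSEQ_imp_Cauchy[OF X(2)] unfolding Cauchy_def by metis
    show "\<exists>N. \<forall>t\<in>{a..b}. \<forall>m\<ge>N. \<forall>n\<ge>N. dist (u m t) (u n t) < e"
    proof (intro exI ballI allI impI)
      fix t m n assume t: "t \<in> {a..b}" and mn: "m \<ge> N" "n \<ge> N"
      have "norm (u m t - u n t) \<le> K * norm (X m - X n)"
        unfolding K_def using sol_diff[OF u[of m] u[of n]] t
        by (intro homogeneous_bound_uniform) auto
      also have "\<dots> < K * (e / K)"
        using N[OF mn] K by (intro mult_strict_left_mono) (auto simp: dist_norm)
      finally show "dist (u m t) (u n t) < e" using K by (simp add: dist_norm)
    qed
  qed
  then obtain u' where u': "uniform_limit {a..b} u u' sequentially"
    using Cauchy_uniformly_convergent unfolding uniformly_convergent_on_def by blast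
  show ?thesis
    using sol_uniform_limit[OF _ u u' _ X(2), of "\<lambda>_. 0"] by (auto intro: uniform_limit_const)
qed

lemma sol_exists:
  assumes ab: "a \<le> b" and x: "x \<in> closure D" and g: "continuous_on {a..b} g"
  shows "\<exists>u. sol a b g x u"
proof -
  obtain u where u: "sol a b (\<lambda>_. 0) x u" using sol_exists_homogeneous[OF ab x] by blast
  obtain v where v: "sol a b g 0 v" by (rule forcing_solution[OF ab g])
  show ?thesis using sol_add_scale[OF u v, of 1] by auto
qed

text \<open>Uniqueness splits every solution into a homogeneous one and a forced one with zero
  start. The factor \<open>\<delta> (t - a)\<close> is kept because its smallness on short intervals
  replaces a Gronwall argument.\<close>

lemma sol_bound:
  assumes u: "sol a b g x u" and t: "t \<in> {a..b}" and G: "\<And>s. s \<in> {a..t} \<Longrightarrow> norm (g s) \<le> G"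
  shows "norm (u t) \<le> M * exp (2 * \<omega> * (b - a)) * norm x + \<delta> (t - a) * G"
proof -
  have ab: "a \<le> b" using t by simp
  have "x \<in> closure D" using sol_start[OF u ab] solD(3)[OF u, of a] ab by auto
  then obtain v where v: "sol a b (\<lambda>_. 0) x v" using sol_exists_homogeneous[OF ab] by blast
  obtain w where w: "sol a b g 0 w"
    and wb: "\<And>t G. t \<in> {a..b} \<Longrightarrow> (\<And>s. s \<in> {a..t} \<Longrightarrow> norm (g s) \<le> G) \<Longrightarrow> norm (w t) \<le> \<delta> (t - a) * G"
    by (rule forcing_solution[OF ab solD(1)[OF u]]) blast
  have "sol a b g x (\<lambda>t. v t + w t)" using sol_add_scale[OF v w, of 1] by simp
  then have "u t = v t + w t" by (rule sol_unique[OF u _ t])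
  then show ?thesis
    using homogeneous_bound_uniform[OF v t] wb[OF t G] norm_triangle_ineq[of "v t" "w t"] by simp
qed

lemma delta_le: "0 \<le> s \<Longrightarrow> s \<le> t \<Longrightarrow> \<delta> s \<le> \<delta> t"
  using delta_mono by (auto simp: mono_on_def)

lemma delta_small:
  assumes "e > 0"
  obtains h where "h > 0" "\<delta> h < e"
proof -
  have "\<forall>\<^sub>F s in at_right 0. \<delta> s < e" using order_tendstoD(2)[OF delta_tendsto_0 assms] .
  then obtain h where h: "h > 0" "\<And>s. 0 < s \<Longrightarrow> s < h \<Longrightarrow> \<delta> s < e"
    by (auto simp: eventually_at_right_field)
  show ?thesis using that[of "h / 2"] h by simp
qed

end

section \<open>The perturbed problem\<close>

locale perturbed = resolvent_forcing D A \<omega> M \<delta>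
  for D :: "'a::banach set" and A \<omega> M \<delta> +
  fixes B :: "real \<Rightarrow> 'a \<Rightarrow> 'a" and b :: "real \<Rightarrow> real"
  assumes B_linear: "bounded_linear_on (closure D) UNIV (B t)"
    and B_cont: "x \<in> closure D \<Longrightarrow> continuous_on UNIV (\<lambda>t. B t x)"
    and b_cont: "continuous_on UNIV b" and b_nonneg: "0 \<le> b t"
    and B_bound: "x \<in> closure D \<Longrightarrow> norm (B t x) \<le> b t * norm x"
begin

lemma B_diff:
  assumes "x \<in> closure D" "y \<in> closure D"
  shows "B t (x - y) = B t x - B t y"
proof -
  have add: "B t (x + y) = B t x + B t y" and scale: "B t (c *\<^sub>R x) = c *\<^sub>R B t x"
    if "x \<in> closure D" "y \<in> closure D" for x y c
    using B_linear[of t] that by (auto simp: bounded_linear_on_def linear_on_def)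
  show ?thesis
    using add[of x "(-1) *\<^sub>R y"] scale[of y y "-1"] assms subspace_scale[OF subspace_X0, of y "-1"] by simp
qed

text \<open>Strong continuity and a locally bounded norm give joint continuity:
  \<open>B (\<tau> q) (y q - y p)\<close> is dominated by
  \<open>b (\<tau> q) * norm (y q - y p)\<close>, and the rest is continuity for the fixed vector
  \<open>y p\<close>.\<close>

lemma B_continuous:
  fixes y :: "'c::topological_space \<Rightarrow> 'a"
  assumes \<tau>: "continuous_on S \<tau>" and y: "continuous_on S y" "y ` S \<subseteq> closure D"
  shows "continuous_on S (\<lambda>p. B (\<tau> p) (y p))"
  unfolding continuous_on_def
proof
  fix p assume p: "p \<in> S"
  let ?F = "at p within S"
  have t: "(\<tau> \<longlongrightarrow> \<tau> p) ?F" and yl: "(y \<longlongrightarrow> y p) ?F"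
    using \<tau> y(1) p by (auto simp: continuous_on_def)
  have yp: "y p \<in> closure D" using y(2) p by auto
  have "((\<lambda>q. b (\<tau> q)) \<longlongrightarrow> b (\<tau> p)) ?F"
    using isCont_tendsto_compose[OF _ t, of b] b_cont by (simp add: continuous_on_eq_continuous_at)
  moreover have "((\<lambda>q. y q - y p) \<longlongrightarrow> 0) ?F" using yl by (simp add: LIM_zero_iff)
  ultimately have "((\<lambda>q. b (\<tau> q) * norm (y q - y p)) \<longlongrightarrow> b (\<tau> p) * norm (0::'a)) ?F"
    by (intro tendsto_intros)
  then have lim: "((\<lambda>q. b (\<tau> q) * norm (y q - y p)) \<longlongrightarrow> 0) ?F" by simp
  have bound: "\<forall>\<^sub>F q in ?F. norm (B (\<tau> q) (y q - y p)) \<le> b (\<tau> q) * norm (y q - y p)"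
    unfolding eventually_at_filter
    by (rule always_eventually) (use y(2) yp in \<open>auto intro!: B_bound subspace_diff[OF subspace_X0]\<close>)
  have 1: "((\<lambda>q. B (\<tau> q) (y q - y p)) \<longlongrightarrow> 0) ?F"
    by (rule Lim_null_comparison[OF bound lim])
  have 2: "((\<lambda>q. B (\<tau> q) (y p)) \<longlongrightarrow> B (\<tau> p) (y p)) ?F"
    using isCont_tendsto_compose[OF _ t, of "\<lambda>t. B t (y p)"] B_cont[OF yp]
    by (simp add: continuous_on_eq_continuous_at)
  have "((\<lambda>q. B (\<tau> q) (y q - y p) + B (\<tau> q) (y p)) \<longlongrightarrow> 0 + B (\<tau> p) (y p)) ?F"
    by (intro tendsto_add 1 2)
  then have 3: "((\<lambda>q. B (\<tau> q) (y q - y p) + B (\<tau> q) (y p)) \<longlongrightarrow> B (\<tau> p) (y p)) ?F" by simp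
  have "\<forall>\<^sub>F q in ?F. B (\<tau> q) (y q - y p) + B (\<tau> q) (y p) = B (\<tau> q) (y q)"
    unfolding eventually_at_filter
    by (rule always_eventually) (use y(2) yp in \<open>auto simp: B_diff\<close>)
  then show "((\<lambda>q. B (\<tau> q) (y q)) \<longlongrightarrow> B (\<tau> p) (y p)) ?F"
    by (rule Lim_transform_eventually[OF 3])
qed

lemma b_bounded:
  obtains \<beta> where "\<beta> \<ge> 0" "\<And>s. s \<in> {p..q} \<Longrightarrow> b s \<le> \<beta>"
proof -
  have "compact (b ` {p..q})"
    using b_cont by (intro compact_continuous_image) (auto intro: continuous_on_subset)
  then have "bounded (b ` {p..q})" by (rule compact_imp_bounded)
  then obtain \<beta> where "\<forall>y\<in>b ` {p..q}. \<bar>y\<bar> \<le> \<beta>"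
    by (auto simp: bounded_iff)
  then have \<beta>: "\<bar>b s\<bar> \<le> \<beta>" if "s \<in> {p..q}" for s using that by simp
  have "b s \<le> max 0 \<beta>" if "s \<in> {p..q}" for s using \<beta>[OF that] by linarith
  then show ?thesis using that[of "max 0 \<beta>"] by simp
qed

lemma contraction_step:
  obtains \<beta> h where "\<beta> \<ge> 0" "\<And>s x. s \<in> {p..q} \<Longrightarrow> x \<in> closure D \<Longrightarrow> norm (B s x) \<le> \<beta> * norm x"
    "h > 0" "\<delta> h * \<beta> \<le> 1 / 2"
proof -
  obtain \<beta> where \<beta>: "\<beta> \<ge> 0" "\<And>s. s \<in> {p..q} \<Longrightarrow> b s \<le> \<beta>" by (rule b_bounded) blast
  \<comment> \<open>The added 1 keeps the quotient defined when \<open>\<beta>\<close> is 0.\<close>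
  obtain h where h: "h > 0" "\<delta> h < 1 / (2 * \<beta> + 1)" using \<beta>(1) by (rule_tac delta_small) auto
  have "\<delta> h * \<beta> \<le> 1 / (2 * \<beta> + 1) * \<beta>" using h \<beta> by (intro mult_right_mono) auto
  also have "\<dots> \<le> 1 / 2" using \<beta>(1) by (simp add: field_simps)
  finally have "\<delta> h * \<beta> \<le> 1 / 2" .
  moreover have "norm (B s x) \<le> \<beta> * norm x" if "s \<in> {p..q}" "x \<in> closure D" for s x
    using B_bound[OF that(2), of s] mult_right_mono[OF \<beta>(2)[OF that(1)], of "norm x"] by simp
  ultimately show ?thesis using that \<beta>(1) h(1) by blast
qed

section \<open>Perturbed solutions on compact intervals\<close>

abbreviation psol :: "real \<Rightarrow> real \<Rightarrow> (real \<Rightarrow> 'a) \<Rightarrow> 'a \<Rightarrow> (real \<Rightarrow> 'a) \<Rightarrow> bool" where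
  "psol a c f x u \<equiv> sol a c (\<lambda>r. B r (u r) + f r) x u"

lemma psol_diff:
  assumes u: "psol a c f x u" and v: "psol a c g y v"
  shows "psol a c (\<lambda>s. f s - g s) (x - y) (\<lambda>s. u s - v s)"
  by (rule sol_cong[OF sol_diff[OF u v]]) (auto simp: B_diff solD(3)[OF u] solD(3)[OF v])

text \<open>On intervals of length at most \<open>h\<close> the perturbation is absorbed into the
  left side; finitely many such intervals cover any subinterval of \<open>{p..q}\<close>. Thus
  \<open>C\<close> depends only on \<open>p\<close> and \<open>q\<close>, which later gives
  uniformity in the starting time.\<close>

lemma psol_bound:
  obtains C where "C \<ge> 0" "\<And>a c x f u G t. p \<le> a \<Longrightarrow> c \<le> q \<Longrightarrow> psol a c f x u \<Longrightarrow>
    (\<And>s. s \<in> {a..c} \<Longrightarrow> norm (f s) \<le> G) \<Longrightarrow> t \<in> {a..c} \<Longrightarrow> norm (u t) \<le> C * (norm x + G)"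
proof -
  obtain \<beta> h where \<beta>: "\<beta> \<ge> 0" "\<And>s x. s \<in> {p..q} \<Longrightarrow> x \<in> closure D \<Longrightarrow> norm (B s x) \<le> \<beta> * norm x"
    and h: "h > 0" "\<delta> h * \<beta> \<le> 1 / 2" by (rule contraction_step[of p q]) blast
  define K where "K = M * exp (2 * \<omega> * (q - p))"
  \<comment> \<open>The doubling comes from moving \<open>1 / 2 * m\<close> to the left in
    \<open>m \<le> K * norm x + 1 / 2 * m + \<delta> h * G\<close>.\<close>
  define C1 where "C1 = 2 * K + 2 * \<delta> h"
  have K: "K \<ge> 0" using M_ge_1 by (simp add: K_def)
  have C1: "C1 \<ge> 0" using K delta_nonneg[of h] h by (simp add: C1_def)
  have short: "norm (u t) \<le> C1 * (norm x + G)"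
    if pq: "p \<le> a" "c \<le> q" and u: "psol a c f x u" and G: "\<And>s. s \<in> {a..c} \<Longrightarrow> norm (f s) \<le> G"
      and t: "t \<in> {a..c}" and len: "c - a \<le> h" for a c x f u G t
  proof -
    have "continuous_on {a..c} (\<lambda>t. norm (u t))" by (intro continuous_intros solD(2)[OF u])
    then obtain t' where t': "t' \<in> {a..c}" "\<And>s. s \<in> {a..c} \<Longrightarrow> norm (u s) \<le> norm (u t')"
      using continuous_attains_sup[of "{a..c}" "\<lambda>t. norm (u t)"] t by auto
    \<comment> \<open>At the maximum point \<open>t'\<close> the total forcing on
      \<open>{a..t'}\<close> is bounded by \<open>\<beta> * m + G\<close>, so
      \<open>sol_bound\<close> yields an inequality with \<open>m\<close> on both sides.\<close>
    define m where "m = norm (u t')"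
    have G0: "G \<ge> 0" using order_trans[OF norm_ge_zero G[OF t]] .
    have "norm (B s (u s) + f s) \<le> \<beta> * m + G" if s: "s \<in> {a..t'}" for s
    proof -
      have s': "s \<in> {a..c}" "s \<in> {p..q}" using s t' pq by auto
      have "norm (B s (u s)) \<le> \<beta> * norm (u s)" by (rule \<beta>(2)[OF s'(2) solD(3)[OF u s'(1)]])
      also have "\<dots> \<le> \<beta> * m" unfolding m_def by (intro mult_left_mono t' s' \<beta>)
      finally show ?thesis using G[OF s'(1)] norm_triangle_ineq[of "B s (u s)" "f s"] by simp
    qed
    then have "m \<le> M * exp (2 * \<omega> * (c - a)) * norm x + \<delta> (t' - a) * (\<beta> * m + G)"
      unfolding m_def by (rule sol_bound[OF u t'(1)])
    also have "\<dots> \<le> K * norm x + \<delta> h * (\<beta> * m + G)"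
      unfolding K_def using pq t' len M_ge_1 omega_nonneg \<beta>(1) G0
      by (intro add_mono mult_right_mono mult_left_mono delta_le) (auto simp: m_def intro!: mult_left_mono)
    also have "\<delta> h * (\<beta> * m + G) = (\<delta> h * \<beta>) * m + \<delta> h * G" by (simp add: algebra_simps)
    also have "(\<delta> h * \<beta>) * m \<le> 1 / 2 * m" by (intro mult_right_mono h) (simp add: m_def)
    finally have "m \<le> 2 * K * norm x + 2 * \<delta> h * G" by simp
    also have "\<dots> \<le> C1 * norm x + C1 * G"
      using K delta_nonneg[of h] h G0 by (intro add_mono mult_right_mono) (auto simp: C1_def)
    finally show ?thesis using t'(2)[OF t] by (simp add: m_def algebra_simps)
  qed
  \<comment> \<open>The claim for intervals of length at most \<open>n * h\<close>, with the
    constant as a parameter so that the induction may enlarge it independently of the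
    solution.\<close>
  define bd where "bd n C \<longleftrightarrow> (\<forall>a c x f u G t. p \<le> a \<longrightarrow> c \<le> q \<longrightarrow> c \<le> a + real n * h \<longrightarrow>
    psol a c f x u \<longrightarrow> (\<forall>s\<in>{a..c}. norm (f s) \<le> G) \<longrightarrow> t \<in> {a..c} \<longrightarrow> norm (u t) \<le> C * (norm x + G))"
    for n :: nat and C
  have "\<exists>C\<ge>0. bd n C" for n
  proof (induction n)
    case 0
    have "norm (u t) \<le> 1 * (norm x + G)"
      if "c \<le> a" "psol a c f x u" "\<forall>s\<in>{a..c}. norm (f s) \<le> G" "t \<in> {a..c}" for a c x f u G t
    proof -
      have "t = a" "a = c" using that by auto
      then show ?thesis using sol_start[OF that(2)] that(3) order_trans[OF norm_ge_zero, of "f a" G] by auto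
    qed
    then have "bd 0 1" unfolding bd_def by simp
    then show ?case by (intro exI[of _ 1]) simp
  next
    case (Suc n)
    then obtain C where C: "C \<ge> 0" "bd n C" by blast
    \<comment> \<open>Up to \<open>d\<close> the old constant serves; beyond it, the short bound
      starts from \<open>norm (u d) \<le> C * (norm x + G)\<close> and gives
      \<open>C1 * (C + 1)\<close>.\<close>
    have "norm (u t) \<le> (C + C1 * (C + 1)) * (norm x + G)"
      if pq: "p \<le> a" "c \<le> q" and len: "c \<le> a + real (Suc n) * h" and u: "psol a c f x u"
        and G: "\<forall>s\<in>{a..c}. norm (f s) \<le> G" and t: "t \<in> {a..c}" for a c x f u G t
    proof -
      define d where "d = min c (a + real n * h)"
      have d: "a \<le> d" "d \<le> c" "d \<le> a + real n * h" "c - d \<le> h"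
        using t len mult_nonneg_nonneg[of "real n" h] h(1)
        by (auto simp: d_def min_def distrib_right)
      have G0: "G \<ge> 0" using order_trans[OF norm_ge_zero bspec[OF G t]] .
      have 1: "norm (u s) \<le> C * (norm x + G)" if "s \<in> {a..d}" for s
        using C(2)[unfolded bd_def, rule_format, OF pq(1) _ d(3) sol_restrict[OF u d(2)], of G s] that d pq G by auto
      show ?thesis
      proof (cases "t \<le> d")
        case True
        then have "norm (u t) \<le> C * (norm x + G)" using 1 t by auto
        also have "\<dots> \<le> (C + C1 * (C + 1)) * (norm x + G)"
          using C(1) C1 G0 by (intro mult_right_mono) auto
        finally show ?thesis .
      next
        case False
        have "norm (u t) \<le> C1 * (norm (u d) + G)"
          using False t d pq G by (intro short[OF _ pq(2) sol_restart[OF u d(1,2)] _ _ d(4)]) auto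
        also have "\<dots> \<le> C1 * (C * (norm x + G) + (norm x + G))"
          using 1[of d] d C1 by (intro mult_left_mono add_mono) auto
        also have "\<dots> = C1 * (C + 1) * (norm x + G)" by (simp add: algebra_simps)
        also have "\<dots> \<le> (C + C1 * (C + 1)) * (norm x + G)"
          using C(1) C1 G0 by (intro mult_right_mono) auto
        finally show ?thesis .
      qed
    qed
    then have "bd (Suc n) (C + C1 * (C + 1))" unfolding bd_def by blast
    then show ?case using C(1) C1 by (intro exI[of _ "C + C1 * (C + 1)"]) simp
  qed
  note * = this
  define n where "n = nat \<lceil>(q - p) / h\<rceil>"
  have n: "q - p \<le> real n * h"
  proof -
    have "(q - p) / h \<le> real n" unfolding n_def by linarith
    then show ?thesis using h(1) by (simp add: field_simps)
  qed
  obtain C where C: "C \<ge> 0" "bd n C" using *[of n] by blast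
  show ?thesis
  proof (rule that[OF C(1)])
    fix a c x f u G t
    assume asm: "p \<le> a" "c \<le> q" "psol a c f x u" "\<And>s. s \<in> {a..c} \<Longrightarrow> norm (f s) \<le> G" "t \<in> {a..c}"
    then have "c \<le> a + real n * h" "\<forall>s\<in>{a..c}. norm (f s) \<le> G" using n by auto
    with asm C(2) show "norm (u t) \<le> C * (norm x + G)" unfolding bd_def by blast
  qed
qed

lemma psol_unique:
  assumes u: "psol a c f x u" and v: "psol a c f x v" and t: "t \<in> {a..c}"
  shows "u t = v t"
proof -
  obtain C where C: "\<And>a' c' x f u G t. a \<le> a' \<Longrightarrow> c' \<le> c \<Longrightarrow> psol a' c' f x u \<Longrightarrow>
    (\<And>s. s \<in> {a'..c'} \<Longrightarrow> norm (f s) \<le> G) \<Longrightarrow> t \<in> {a'..c'} \<Longrightarrow> norm (u t) \<le> C * (norm x + G)"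
    by (rule psol_bound[of a c]) blast
  have "norm (u t - v t) \<le> C * (norm (x - x) + 0)"
    using C[OF order_refl order_refl psol_diff[OF u v], of 0 t] t by simp
  then show ?thesis by simp
qed

text \<open>Picard iteration with the perturbation frozen at the previous iterate: each step solves
  an unperturbed problem, and \<open>\<delta> h * \<beta> \<le> 1 / 2\<close> halves the distance
  between consecutive iterates.\<close>

lemma psol_exists_short:
  assumes ac: "a \<le> c" and x: "x \<in> closure D" and f: "continuous_on {a..c} f"
    and \<beta>: "\<beta> \<ge> 0" "\<And>s x. s \<in> {a..c} \<Longrightarrow> x \<in> closure D \<Longrightarrow> norm (B s x) \<le> \<beta> * norm x"
    and h: "c - a \<le> h" "\<delta> h * \<beta> \<le> 1 / 2"
  shows "\<exists>u. psol a c f x u"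
proof -
  define \<Phi> where "\<Phi> u = (SOME v. sol a c (\<lambda>r. B r (u r) + f r) x v)" for u
  define u where "u n = (\<Phi> ^^ n) (\<lambda>_. x)" for n
  have \<Phi>: "sol a c (\<lambda>r. B r (u r) + f r) x (\<Phi> u)"
    if "continuous_on {a..c} u" "u ` {a..c} \<subseteq> closure D" for u
  proof -
    have "continuous_on {a..c} (\<lambda>r. B r (u r) + f r)"
      by (intro continuous_intros f B_continuous that)
    from someI_ex[OF sol_exists[OF ac x this]] show ?thesis unfolding \<Phi>_def .
  qed
  have uc: "continuous_on {a..c} (u n) \<and> u n ` {a..c} \<subseteq> closure D" for n
  proof (induction n)
    case 0 then show ?case using x by (auto simp: u_def)
  next
    case (Suc n)
    then have "sol a c (\<lambda>r. B r (u n r) + f r) x (u (Suc n))" using \<Phi> by (simp add: u_def)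
    then show ?case by (auto simp: sol_def)
  qed
  have us: "sol a c (\<lambda>r. B r (u n r) + f r) x (u (Suc n))" for n
    using \<Phi>[of "u n"] uc[of n] by (simp add: u_def)
  have uX: "u n s \<in> closure D" if "s \<in> {a..c}" for n s using uc[of n] that by auto
  have "bounded ((\<lambda>t. u 1 t - u 0 t) ` {a..c})"
    using uc[of 0] uc[of 1] by (intro compact_imp_bounded compact_continuous_image continuous_intros) auto
  then obtain m where "\<forall>y\<in>(\<lambda>t. u 1 t - u 0 t) ` {a..c}. norm y \<le> m"
    unfolding bounded_iff by blast
  then have m: "norm (u 1 t - u 0 t) \<le> m" if "t \<in> {a..c}" for t using that by simp
  have m0: "m \<ge> 0" using order_trans[OF norm_ge_zero m[of a]] ac by auto
  have step: "norm (u (Suc n) t - u n t) \<le> m * (1 / 2) ^ n" if "t \<in> {a..c}" for n t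
    using that
  proof (induction n arbitrary: t)
    case 0 then show ?case using m by simp
  next
    case (Suc n)
    \<comment> \<open>Consecutive iterates share the initial value, so the homogeneous part of
      \<open>sol_bound\<close> vanishes and only the contracting part remains.\<close>
    have "sol a c (\<lambda>r. B r (u (Suc n) r) + f r - (B r (u n r) + f r)) (x - x) (\<lambda>t. u (Suc (Suc n)) t - u (Suc n) t)"
      by (rule sol_diff[OF us us])
    then have "norm (u (Suc (Suc n)) t - u (Suc n) t) \<le>
        M * exp (2 * \<omega> * (c - a)) * norm (x - x) + \<delta> (t - a) * (\<beta> * (m * (1 / 2) ^ n))"
    proof (rule sol_bound[OF _ Suc.prems])
      fix s assume "s \<in> {a..t}"
      then have s: "s \<in> {a..c}" using Suc.prems by auto
      have "B s (u (Suc n) s) + f s - (B s (u n s) + f s) = B s (u (Suc n) s - u n s)"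
        using uX[OF s] by (simp add: B_diff)
      also have "norm \<dots> \<le> \<beta> * norm (u (Suc n) s - u n s)"
        by (intro \<beta> s subspace_diff[OF subspace_X0] uX)
      also have "\<dots> \<le> \<beta> * (m * (1 / 2) ^ n)" by (intro mult_left_mono Suc.IH s \<beta>)
      finally show "norm (B s (u (Suc n) s) + f s - (B s (u n s) + f s)) \<le> \<beta> * (m * (1 / 2) ^ n)" .
    qed
    also have "\<dots> = (\<delta> (t - a) * \<beta>) * (m * (1 / 2) ^ n)" by simp
    also have "\<dots> \<le> 1 / 2 * (m * (1 / 2) ^ n)"
    proof (rule mult_right_mono)
      have "\<delta> (t - a) * \<beta> \<le> \<delta> h * \<beta>"
        using Suc.prems h by (intro mult_right_mono delta_le \<beta>) auto
      then show "\<delta> (t - a) * \<beta> \<le> 1 / 2" using h by simp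
    qed (use m0 in simp)
    finally show ?case by simp
  qed
  \<comment> \<open>The telescoping series of the iterates is dominated by a geometric one.\<close>
  have "uniform_limit {a..c} (\<lambda>n t. \<Sum>i<n. u (Suc i) t - u i t) (\<lambda>t. \<Sum>i. u (Suc i) t - u i t) sequentially"
    using step by (rule Weierstrass_m_test) (auto intro!: summable_mult summable_geometric)
  then have "uniform_limit {a..c} (\<lambda>n t. u 0 t + (\<Sum>i<n. u (Suc i) t - u i t))
      (\<lambda>t. u 0 t + (\<Sum>i. u (Suc i) t - u i t)) sequentially"
    by (intro uniform_limit_intros)
  then obtain u' where u': "uniform_limit {a..c} u u' sequentially"
    by (simp add: sum_lessThan_telescope[of "\<lambda>i. u i _"])
  have u'X: "u' t \<in> closure D" if t: "t \<in> {a..c}" for t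
    by (rule Lim_in_closed_set[OF closed_closure _ sequentially_bot tendsto_uniform_limitI[OF u' t]])
      (use uX t in auto)
  have "uniform_limit {a..c} (\<lambda>n r. B r (u n r) + f r) (\<lambda>r. B r (u' r) + f r) sequentially"
    unfolding uniform_limit_iff
  proof (intro allI impI)
    fix e :: real assume e: "e > 0"
    then have "e / (\<beta> + 1) > 0" using \<beta>(1) by simp
    then have "\<forall>\<^sub>F n in sequentially. \<forall>t\<in>{a..c}. dist (u n t) (u' t) < e / (\<beta> + 1)"
      using u' unfolding uniform_limit_iff by blast
    then show "\<forall>\<^sub>F n in sequentially. \<forall>t\<in>{a..c}. dist (B t (u n t) + f t) (B t (u' t) + f t) < e"
    proof eventually_elim
      case (elim n)
      show ?case
      proof
        fix t assume t: "t \<in> {a..c}"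
        have "norm (B t (u n t - u' t)) \<le> \<beta> * norm (u n t - u' t)"
          by (intro \<beta> t subspace_diff[OF subspace_X0] uX u'X)
        also have "\<dots> \<le> (\<beta> + 1) * norm (u n t - u' t)" by (intro mult_right_mono) auto
        also have "\<dots> < (\<beta> + 1) * (e / (\<beta> + 1))"
          using bspec[OF elim t] \<beta>(1) by (intro mult_strict_left_mono) (auto simp: dist_norm)
        also have "\<dots> = e" using \<beta>(1) by simp
        finally show "dist (B t (u n t) + f t) (B t (u' t) + f t) < e"
          using uX[OF t] u'X[OF t] by (simp add: dist_norm B_diff)
      qed
    qed
  qed
  moreover have "uniform_limit {a..c} (\<lambda>n. u (Suc n)) u' sequentially"
    using u' unfolding uniform_limit_iff eventually_sequentially by (meson le_SucI)
  ultimately have "psol a c f x u'"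
    by (intro sol_uniform_limit[OF sequentially_bot us _ _ tendsto_const])
  then show ?thesis by (intro exI)
qed

text \<open>The admissible length \<open>h\<close> depends on the interval and not on the initial
  value, so it does not shrink from one restart to the next and \<open>c\<close> is reached in
  finitely many steps.\<close>

lemma psol_exists:
  assumes ac: "a \<le> c" and x: "x \<in> closure D" and f: "continuous_on {a..c} f"
  shows "\<exists>u. psol a c f x u"
proof -
  obtain \<beta> h where \<beta>: "\<beta> \<ge> 0" "\<And>s x. s \<in> {a..c} \<Longrightarrow> x \<in> closure D \<Longrightarrow> norm (B s x) \<le> \<beta> * norm x"
    and h: "h > 0" "\<delta> h * \<beta> \<le> 1 / 2" by (rule contraction_step[of a c]) blast
  have *: "\<exists>u. psol a d f x u" if "a \<le> d" "d \<le> c" "d \<le> a + real n * h" for n d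
    using that
  proof (induction n arbitrary: d)
    case 0
    then have "d = a" by simp
    then have "psol a d f x (\<lambda>_. x)"
      using x by (auto simp: sol_def A_0 subspace_0[OF subspace_D])
    then show ?case by (intro exI)
  next
    case (Suc n)
    define e where "e = min d (a + real n * h)"
    have e: "a \<le> e" "e \<le> d" "e \<le> a + real n * h" "d - e \<le> h" "e \<le> c"
      using Suc.prems mult_nonneg_nonneg[of "real n" h] h(1)
      by (auto simp: e_def min_def distrib_right)
    obtain u where u: "psol a e f x u" using Suc.IH[of e] e by blast
    have ue: "u e \<in> closure D" using solD(3)[OF u, of e] e by auto
    have fc: "continuous_on {e..d} f"
      using e Suc.prems by (intro continuous_on_subset[OF f]) auto
    have "\<exists>w. psol e d f (u e) w"
      by (rule psol_exists_short[OF e(2) ue fc \<beta>(1) _ e(4) h(2)]) (use e Suc.prems \<beta>(2) in auto)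
    then obtain w where w: "psol e d f (u e) w" by blast
    define v where "v t = (if t \<le> e then u t else w t)" for t
    have we: "w e = u e" by (rule sol_start[OF w e(2)])
    \<comment> \<open>The forcing contains the solution itself. Both pieces are rewritten with the
      glued function \<open>v\<close>, since gluing requires a common forcing.\<close>
    have "sol a e (\<lambda>r. B r (v r) + f r) x u"
      by (rule sol_cong[OF u]) (auto simp: v_def)
    moreover have "sol e d (\<lambda>r. B r (v r) + f r) (u e) w"
      by (rule sol_cong[OF w]) (auto simp: v_def we)
    ultimately have "psol a d f x v"
      unfolding v_def[abs_def] using e by (intro sol_concat)
    then show ?case by (intro exI)
  qed
  define n where "n = nat \<lceil>(c - a) / h\<rceil>"
  have "(c - a) / h \<le> real n" unfolding n_def by linarith
  then have "c \<le> a + real n * h" using h(1) by (simp add: field_simps)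
  then show ?thesis using *[of c n] ac by simp
qed

section \<open>Passage to half-lines\<close>

lemma integrated_solution_iff_psol:
  assumes f: "continuous_on {t0..} f"
  shows "integrated_solution D A B f t0 x u \<longleftrightarrow> (\<forall>T\<ge>t0. psol t0 T f x u)"
proof
  assume u: "integrated_solution D A B f t0 x u"
  have uc: "continuous_on {t0..} u" and uX: "u ` {t0..} \<subseteq> closure D"
    using u by (auto simp: integrated_solution_def)
  show "\<forall>T\<ge>t0. psol t0 T f x u"
  proof (intro allI impI)
    fix T assume T: "T \<ge> t0"
    have sub: "{t0..T} \<subseteq> {t0..}" by auto
    have "continuous_on {t0..} (\<lambda>r. B r (u r) + f r)"
      by (intro continuous_intros B_continuous f uc uX)
    then have "continuous_on {t0..T} (\<lambda>r. B r (u r) + f r)" "continuous_on {t0..T} u"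
      using uc sub continuous_on_subset by blast+
    then show "psol t0 T f x u"
      using u unfolding sol_def integrated_solution_def by auto
  qed
next
  assume u: "\<forall>T\<ge>t0. psol t0 T f x u"
  then have uT: "psol t0 T f x u" if "T \<ge> t0" for T using that by blast
  have "continuous_on {t0..} u"
    unfolding continuous_on_eq_continuous_within
  proof
    fix t assume t: "t \<in> {t0..}"
    have "continuous (at t within {t0..t + 1}) u"
      using solD(2)[OF uT[of "t + 1"]] t by (auto simp: continuous_on_eq_continuous_within)
    \<comment> \<open>Continuity at \<open>t\<close> is decided to the right as far as
      \<open>t + 1\<close>, so one compact interval suffices.\<close>
    moreover have "at t within {t0..} = at t within {t0..t + 1}"
      by (rule at_within_nhd[of t "{..<t + 1}"]) (use t in auto)
    ultimately show "continuous (at t within {t0..}) u" by simp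
  qed
  moreover have "u t \<in> closure D \<and> integral {t0..t} u \<in> D \<and>
      u t = x + A (integral {t0..t} u) + integral {t0..t} (\<lambda>r. B r (u r) + f r)" if "t \<ge> t0" for t
    using solD(3-5)[OF uT[OF that], of t] that by auto
  ultimately show "integrated_solution D A B f t0 x u"
    unfolding integrated_solution_def by blast
qed

lemma integrated_solution_exists:
  assumes f: "continuous_on {t0..} f" and x: "x \<in> closure D"
  shows "\<exists>u. integrated_solution D A B f t0 x u"
proof -
  have "\<exists>u. psol t0 T f x u" if "T \<ge> t0" for T
    by (rule psol_exists[OF that x continuous_on_subset[OF f]]) auto
  then have "\<forall>T. \<exists>u. T \<ge> t0 \<longrightarrow> psol t0 T f x u" by blast
  from choice[OF this] obtain v where "\<forall>T. T \<ge> t0 \<longrightarrow> psol t0 T f x (v T)" by (rule exE)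
  then have v: "psol t0 T f x (v T)" if "T \<ge> t0" for T using that by blast
  \<comment> \<open>The solution chosen on \<open>{t0..t}\<close> is evaluated at its right end;
    uniqueness makes this agree with every longer solution.\<close>
  have "psol t0 T f x (\<lambda>t. v t t)" if T: "T \<ge> t0" for T
  proof -
    have eq: "v T t = v t t" if "t \<in> {t0..T}" for t
      using that T by (intro psol_unique[OF sol_restrict[OF v[of T]] v[of t]]) auto
    show ?thesis by (rule sol_cong[OF v[OF T]]) (simp_all add: eq)
  qed
  then have "integrated_solution D A B f t0 x (\<lambda>t. v t t)"
    unfolding integrated_solution_iff_psol[OF f] by (intro allI impI)
  then show ?thesis by (intro exI)
qed

lemma integrated_solution_unique:
  assumes f: "continuous_on {t0..} f"
    and "integrated_solution D A B f t0 x u" "integrated_solution D A B f t0 x v" and t: "t \<ge> t0"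
  shows "u t = v t"
proof (rule psol_unique)
  show "psol t0 t f x u" "psol t0 t f x v"
    using assms by (auto simp: integrated_solution_iff_psol[OF f])
qed (use t in simp)

section \<open>The evolution family\<close>

abbreviation U :: "real \<Rightarrow> real \<Rightarrow> 'a \<Rightarrow> 'a" where "U \<equiv> evol D A B"

text \<open>Uniqueness gives the definite description in \<open>evol\<close> its meaning: all
  solutions have the same value at \<open>t\<close>.\<close>

lemma integrated_solution_eq_U:
  assumes "integrated_solution D A B (\<lambda>_. 0) s x u" and "s \<le> t"
  shows "U t s x = u t"
  unfolding evol_def using assms integrated_solution_unique[of s "\<lambda>_. 0" x]
  by (intro the_equality) auto

lemma psol_U:
  assumes x: "x \<in> closure D" and sT: "s \<le> T"
  shows "psol s T (\<lambda>_. 0) x (\<lambda>t. U t s x)"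
proof -
  obtain u where u: "integrated_solution D A B (\<lambda>_. 0) s x u"
    using integrated_solution_exists[OF _ x, of s "\<lambda>_. 0"] by auto
  have "psol s T (\<lambda>_. 0) x u" using u sT by (auto simp: integrated_solution_iff_psol)
  then show ?thesis by (rule sol_cong) (simp_all add: integrated_solution_eq_U[OF u])
qed

lemma psol_eq_U:
  assumes u: "psol s T (\<lambda>_. 0) x u" and t: "t \<in> {s..T}"
  shows "u t = U t s x"
proof -
  have "x \<in> closure D" using sol_start[OF u] solD(3)[OF u, of s] t by auto
  then show ?thesis using t by (intro psol_unique[OF u psol_U]) auto
qed

lemma U_in_X0: "x \<in> closure D \<Longrightarrow> s \<le> t \<Longrightarrow> U t s x \<in> closure D"
  using solD(3)[OF psol_U[of x s t], of t] by simp

lemma U_start: "x \<in> closure D \<Longrightarrow> U s s x = x"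
  using sol_start[OF psol_U[of x s s]] by simp

lemma U_cocycle:
  assumes "x \<in> closure D" "s \<le> r" "r \<le> t"
  shows "U t r (U r s x) = U t s x"
  using psol_eq_U[OF sol_restart[OF psol_U[of x s t]], of r t] assms by simp

lemma U_diff:
  assumes "x \<in> closure D" "y \<in> closure D" "s \<le> t"
  shows "U t s (x - y) = U t s x - U t s y"
proof -
  have "psol s t (\<lambda>_. 0) (x - y) (\<lambda>t. U t s x - U t s y)"
    using psol_diff[OF psol_U psol_U, of x s t y] assms by simp
  from psol_eq_U[OF this, of t] show ?thesis using assms by simp
qed

lemma U_bounded:
  obtains C where "C \<ge> 0" "\<And>s t x. p \<le> s \<Longrightarrow> s \<le> t \<Longrightarrow> t \<le> q \<Longrightarrow> x \<in> closure D \<Longrightarrow>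
    norm (U t s x) \<le> C * norm x"
proof -
  obtain C where C: "C \<ge> 0" "\<And>a c x f u G t. p \<le> a \<Longrightarrow> c \<le> q \<Longrightarrow> psol a c f x u \<Longrightarrow>
    (\<And>s. s \<in> {a..c} \<Longrightarrow> norm (f s) \<le> G) \<Longrightarrow> t \<in> {a..c} \<Longrightarrow> norm (u t) \<le> C * (norm x + G)"
    by (rule psol_bound[of p q]) blast
  have "norm (U t s x) \<le> C * norm x" if "p \<le> s" "s \<le> t" "t \<le> q" "x \<in> closure D" for s t x
    using C(2)[OF that(1,3) psol_U[OF that(4,2)], of 0 t] that by simp
  then show ?thesis using that C(1) by blast
qed

text \<open>For \<open>y\<close> in \<open>D\<close> the difference \<open>U r s y - y\<close>
  solves the unperturbed problem with zero start and forcing \<open>A y + B r (U r s y)\<close>. The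
  forcing is bounded by \<open>G\<close>, so \<open>\<delta> (t - s) * G\<close> is a bound uniform
  in \<open>s\<close>.\<close>

lemma U_near_identity_D:
  assumes y: "y \<in> D" and e: "e > 0"
  obtains d where "d > 0"
    "\<And>s t. p \<le> s \<Longrightarrow> s \<le> t \<Longrightarrow> t \<le> q \<Longrightarrow> t - s < d \<Longrightarrow> norm (U t s y - y) < e"
proof -
  obtain C where C: "C \<ge> 0" "\<And>s t x. p \<le> s \<Longrightarrow> s \<le> t \<Longrightarrow> t \<le> q \<Longrightarrow> x \<in> closure D \<Longrightarrow>
    norm (U t s x) \<le> C * norm x" by (rule U_bounded[of p q]) blast
  obtain \<beta> where \<beta>: "\<beta> \<ge> 0" "\<And>s x. s \<in> {p..q} \<Longrightarrow> x \<in> closure D \<Longrightarrow> norm (B s x) \<le> \<beta> * norm x"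
    by (rule contraction_step[of p q]) blast
  define G where "G = norm (A y) + \<beta> * (C * norm y)"
  have G: "G \<ge> 0" using C \<beta> by (simp add: G_def)
  obtain h where h: "h > 0" "\<delta> h < e / (G + 1)"
    using e G by (rule_tac delta_small[of "e / (G + 1)"]) auto
  have "norm (U t s y - y) < e" if st: "p \<le> s" "s \<le> t" "t \<le> q" "t - s < h" for s t
  proof -
    note yX = D_X0[OF y]
    note u = psol_U[OF yX st(2)]
    have "sol s t (\<lambda>r. A y + (B r (U r s y) + 0)) 0 (\<lambda>r. U r s y - y)"
      unfolding sol_def
    proof (intro conjI ballI)
      fix r assume r: "r \<in> {s..t}"
      have I: "integral {s..r} (\<lambda>r. U r s y - y) = integral {s..r} (\<lambda>r. U r s y) - (r - s) *\<^sub>R y"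
        using r by (subst integral_diff) (auto intro: sol_integrable[OF u])
      have J: "integral {s..r} (\<lambda>r. A y + (B r (U r s y) + 0)) =
          (r - s) *\<^sub>R A y + integral {s..r} (\<lambda>r. B r (U r s y) + 0)"
        using r sol_integrable(2)[OF u, of s r] by (subst integral_add) auto
      note D = solD(4)[OF u r] subspace_scale[OF subspace_D y]
      show "integral {s..r} (\<lambda>r. U r s y - y) \<in> D"
        unfolding I by (intro subspace_diff[OF subspace_D] D)
      show "U r s y - y = 0 + A (integral {s..r} (\<lambda>r. U r s y - y)) +
          integral {s..r} (\<lambda>r. A y + (B r (U r s y) + 0))"
        unfolding I J A_diff[OF D] A_scale[OF y] by (subst solD(5)[OF u r]) simp
    next
      show "(\<lambda>r. U r s y - y) ` {s..t} \<subseteq> closure D"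
        using solD(3)[OF u] by (auto intro!: subspace_diff[OF subspace_X0] yX)
    qed (intro continuous_intros solD(1,2)[OF u])+
    then have "norm (U t s y - y) \<le> M * exp (2 * \<omega> * (t - s)) * norm (0::'a) + \<delta> (t - s) * G"
    proof (rule sol_bound)
      fix r assume r: "r \<in> {s..t}"
      have "norm (B r (U r s y)) \<le> \<beta> * norm (U r s y)"
        using r st by (intro \<beta> U_in_X0 yX) auto
      also have "\<dots> \<le> \<beta> * (C * norm y)" using r st by (intro mult_left_mono C \<beta> yX) auto
      finally show "norm (A y + (B r (U r s y) + 0)) \<le> G"
        unfolding G_def using norm_triangle_ineq[of "A y" "B r (U r s y)"] by simp
    qed (use st in auto)
    also have "\<dots> \<le> \<delta> h * (G + 1)"
      using st G delta_nonneg[of h] h by (auto intro!: mult_mono delta_le)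
    also have "\<dots> < e / (G + 1) * (G + 1)" using h G by (intro mult_strict_right_mono) auto
    also have "\<dots> = e" using G by simp
    finally show ?thesis .
  qed
  then show ?thesis using that h(1) by blast
qed

text \<open>Density of \<open>D\<close> in \<open>X\<^sub>0\<close> and the uniform bound
  \<open>C\<close>; the errors \<open>C * e'\<close>, \<open>e'\<close> and \<open>e'\<close>
  determine \<open>e'\<close>.\<close>

lemma U_near_identity:
  assumes x: "x \<in> closure D" and e: "e > 0"
  obtains d where "d > 0"
    "\<And>s t. p \<le> s \<Longrightarrow> s \<le> t \<Longrightarrow> t \<le> q \<Longrightarrow> t - s < d \<Longrightarrow> norm (U t s x - x) < e"
proof -
  obtain C where C: "C \<ge> 0" "\<And>s t x. p \<le> s \<Longrightarrow> s \<le> t \<Longrightarrow> t \<le> q \<Longrightarrow> x \<in> closure D \<Longrightarrow>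
    norm (U t s x) \<le> C * norm x" by (rule U_bounded[of p q]) blast
  define e' where "e' = e / (C + 2)"
  have e': "e' > 0" "(C + 2) * e' = e" using e C by (auto simp: e'_def)
  obtain y where y: "y \<in> D" "norm (y - x) < e'"
    using x e' by (auto simp: closure_approachable dist_norm)
  obtain d where d: "d > 0"
    "\<And>s t. p \<le> s \<Longrightarrow> s \<le> t \<Longrightarrow> t \<le> q \<Longrightarrow> t - s < d \<Longrightarrow> norm (U t s y - y) < e'"
    by (rule U_near_identity_D[OF y(1) e'(1), of p q]) blast
  have "norm (U t s x - x) < e" if st: "p \<le> s" "s \<le> t" "t \<le> q" "t - s < d" for s t
  proof -
    have "U t s x - x = - U t s (y - x) + (U t s y - y) + (y - x)"
      using U_diff[OF D_X0[OF y(1)] x st(2)] by simp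
    also have "norm \<dots> \<le> norm (- U t s (y - x)) + norm (U t s y - y) + norm (y - x)"
      by (rule norm_add3_le)
    also have "\<dots> < C * e' + e' + e'"
    proof -
      have "norm (U t s (y - x)) \<le> C * norm (y - x)"
        using st by (intro C subspace_diff[OF subspace_X0] x D_X0[OF y(1)]) auto
      also have "\<dots> \<le> C * e'" using y C by (intro mult_left_mono) auto
      finally show ?thesis using d(2)[OF st] y by simp
    qed
    also have "\<dots> = e" using e'(2) by (simp add: algebra_simps)
    finally show ?thesis .
  qed
  then show ?thesis using that d(1) by blast
qed

text \<open>Taking \<open>max t s\<close> extends the function from the triangle to the square by
  \<open>f s\<close>, the form required by the triangle lemmas. The argument changes the vector,
  then the starting time, then the end time.\<close>

lemma U_continuous:
  assumes f: "continuous_on {p..q} f" "f ` {p..q} \<subseteq> closure D"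
  shows "continuous_on ({p..q} \<times> {p..q}) (\<lambda>(t, s). U (max t s) s (f s))"
  unfolding continuous_on_iff
proof (intro ballI allI impI)
  fix z0 and e :: real assume z0: "z0 \<in> {p..q} \<times> {p..q}" and e: "e > 0"
  obtain t0 s0 where z0_eq: "z0 = (t0, s0)" by (cases z0)
  have t0: "t0 \<in> {p..q}" and s0: "s0 \<in> {p..q}" using z0 z0_eq by auto
  define x where "x = f s0"
  have x: "x \<in> closure D" using f(2) s0 by (auto simp: x_def)
  obtain C where C: "C \<ge> 0" "\<And>s t x. p \<le> s \<Longrightarrow> s \<le> t \<Longrightarrow> t \<le> q \<Longrightarrow> x \<in> closure D \<Longrightarrow>
    norm (U t s x) \<le> C * norm x" by (rule U_bounded[of p q]) blast
  \<comment> \<open>The three changes cost \<open>C * e'\<close>, \<open>(C + 1) * e'\<close> and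
    \<open>e'\<close>.\<close>
  define e' where "e' = e / (2 * C + 2)"
  have e': "e' > 0" "(2 * C + 2) * e' = e" using e C by (auto simp: e'_def)
  obtain d1 where d1: "d1 > 0" "\<And>s t. p \<le> s \<Longrightarrow> s \<le> t \<Longrightarrow> t \<le> q \<Longrightarrow> t - s < d1 \<Longrightarrow> norm (U t s x - x) < e'"
    by (rule U_near_identity[OF x e'(1), of p q]) blast
  obtain d2 where d2: "d2 > 0" "\<And>s. s \<in> {p..q} \<Longrightarrow> dist s s0 < d2 \<Longrightarrow> dist (f s) x < e'"
    using f(1) s0 e'(1) unfolding continuous_on_iff x_def by metis
  have "continuous_on {p..q} (\<lambda>t. U (max t s0) s0 x)"
    using s0 by (intro continuous_on_compose2[OF solD(2)[OF psol_U[OF x, of s0 q]]] continuous_intros) auto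
  then obtain d3 where d3: "d3 > 0" "\<And>t. t \<in> {p..q} \<Longrightarrow> dist t t0 < d3 \<Longrightarrow>
      dist (U (max t s0) s0 x) (U (max t0 s0) s0 x) < e'"
    using t0 e'(1) unfolding continuous_on_iff by metis
  \<comment> \<open>Behind both starting times, the cocycle law reduces the change to
    \<open>U t s'\<close> applied to \<open>x - U s' s x\<close>; between them only
    \<open>U t s x - x\<close> remains, and before them nothing. Near-identity uniform in
    \<open>s\<close> covers starting times on either side of \<open>s0\<close>.\<close>
  have vary: "norm (U (max t s') s' x - U (max t s) s x) \<le> (C + 1) * e'"
    if t: "t \<in> {p..q}" and s: "p \<le> s" "s \<le> s'" "s' \<le> q" "s' - s < d1" for t s s'
  proof -
    consider "t \<le> s" | "s \<le> t" "t \<le> s'" | "s' \<le> t" using s by linarith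
    then show ?thesis
    proof cases
      case 1
      then show ?thesis using s x C e' by (simp add: max_def U_start)
    next
      case 2
      then have "norm (U (max t s') s' x - U (max t s) s x) = norm (U t s x - x)"
        using s x by (simp add: max_def U_start norm_minus_commute)
      also have "\<dots> \<le> e'" using d1(2)[of s t] 2 s t by auto
      also have "\<dots> \<le> (C + 1) * e'" using C e' by simp
      finally show ?thesis .
    next
      case 3
      have "U (max t s') s' x - U (max t s) s x = U t s' (x - U s' s x)"
        using 3 s x by (simp add: max_absorb1 U_diff U_in_X0 U_cocycle)
      also have "norm \<dots> \<le> C * norm (x - U s' s x)"
        using 3 s t x by (intro C subspace_diff[OF subspace_X0] U_in_X0) auto
      also have "\<dots> \<le> C * e'"
        using d1(2)[of s s'] s C by (intro mult_left_mono) (auto simp: norm_minus_commute)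
      also have "\<dots> \<le> (C + 1) * e'" using e' by (intro mult_right_mono) auto
      finally show ?thesis .
    qed
  qed
  show "\<exists>d>0. \<forall>z\<in>{p..q} \<times> {p..q}. dist z z0 < d \<longrightarrow>
      dist (case z of (t, s) \<Rightarrow> U (max t s) s (f s)) (case z0 of (t, s) \<Rightarrow> U (max t s) s (f s)) < e"
  proof (intro exI[of _ "min d1 (min d2 d3)"] conjI ballI impI)
    fix z assume z: "z \<in> {p..q} \<times> {p..q}" and near: "dist z z0 < min d1 (min d2 d3)"
    obtain t s where z_eq: "z = (t, s)" by (cases z)
    have t: "t \<in> {p..q}" and s: "s \<in> {p..q}" using z z_eq by auto
    have ds: "dist t t0 < min d1 (min d2 d3)" "dist s s0 < min d1 (min d2 d3)"
      using near dist_fst_le[of z z0] dist_snd_le[of z z0] by (auto simp: z_eq z0_eq)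
    have fs: "f s \<in> closure D" using f(2) s by auto
    have eq: "U (max t s) s (f s) - U (max t0 s0) s0 x = U (max t s) s (f s - x) +
        (U (max t s) s x - U (max t s0) s0 x) + (U (max t s0) s0 x - U (max t0 s0) s0 x)"
      by (simp add: U_diff fs x)
    have "norm (U (max t s) s (f s) - U (max t0 s0) s0 x) \<le> norm (U (max t s) s (f s - x)) +
        norm (U (max t s) s x - U (max t s0) s0 x) + norm (U (max t s0) s0 x - U (max t0 s0) s0 x)"
      unfolding eq by (rule norm_add3_le)
    also have "\<dots> < C * e' + (C + 1) * e' + e'"
    proof (intro add_le_less_mono add_mono)
      have "norm (U (max t s) s (f s - x)) \<le> C * norm (f s - x)"
        using s t fs x by (intro C subspace_diff[OF subspace_X0]) auto
      also have "\<dots> \<le> C * e'"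
        using d2(2)[OF s] ds C by (intro mult_left_mono) (auto simp: dist_norm)
      finally show "norm (U (max t s) s (f s - x)) \<le> C * e'" .
      show "norm (U (max t s) s x - U (max t s0) s0 x) \<le> (C + 1) * e'"
      proof (cases "s0 \<le> s")
        case True
        then show ?thesis using ds s s0 by (intro vary[OF t]) (auto simp: dist_real_def)
      next
        case False
        then have "norm (U (max t s0) s0 x - U (max t s) s x) \<le> (C + 1) * e'"
          using ds s s0 by (intro vary[OF t]) (auto simp: dist_real_def)
        then show ?thesis by (simp add: norm_minus_commute)
      qed
      show "norm (U (max t s0) s0 x - U (max t0 s0) s0 x) < e'"
        using d3(2)[OF t] ds by (simp add: dist_norm)
    qed
    also have "\<dots> = e" using e'(2) by (simp add: algebra_simps)
    finally show "dist (case z of (t, s) \<Rightarrow> U (max t s) s (f s)) (case z0 of (t, s) \<Rightarrow> U (max t s) s (f s)) < e"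
      by (simp add: z_eq z0_eq dist_norm x_def)
  qed (use d1 d2 d3 in auto)
qed

section \<open>Convolutions with the evolution family\<close>

text \<open>For a forcing term with values in \<open>X\<^sub>0\<close>, closedness of \<open>A\<close> and interchanging the order of
  integration over the triangle show that the convolution is a solution.\<close>

lemma variation_of_constants:
  assumes ac: "a \<le> c" and f: "continuous_on {a..c} f" "f ` {a..c} \<subseteq> closure D"
  shows "psol a c f 0 (\<lambda>t. integral {a..t} (\<lambda>s. U t s (f s)))"
proof -
  \<comment> \<open>On the domain of integration \<open>s \<le> t\<close> this is
    \<open>U t s (f s)\<close>; the extension makes it continuous on the square.\<close>
  define F where "F t s = U (max t s) s (f s)" for t s
  define V where "V t = integral {a..t} (F t)" for t
  have fX: "f s \<in> closure D" if "s \<in> {a..c}" for s using f(2) that by auto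
  have Fcont: "continuous_on ({a..c} \<times> {a..c}) (\<lambda>(t, s). F t s)"
    unfolding F_def by (rule U_continuous[OF f])
  have FX: "F t s \<in> closure D" if "s \<in> {a..c}" for t s
    unfolding F_def using fX[OF that] by (intro U_in_X0) auto
  have BF: "continuous_on ({a..c} \<times> {a..c}) (\<lambda>(t, s). B t (F t s))"
    unfolding case_prod_unfold
    by (rule B_continuous) (use Fcont FX in \<open>auto simp: case_prod_unfold intro!: continuous_intros\<close>)
  have sub: "{a..t} \<times> {a..t} \<subseteq> {a..c} \<times> {a..c}" if "t \<le> c" for t using that by auto
  have Fr: "continuous_on {a..c} (F r)" "continuous_on {a..c} (\<lambda>s. B r (F r s))" if "r \<in> {a..c}" for r
    using that by (auto intro!: continuous_on_compose_Pair_curried[OF Fcont] continuous_on_compose_Pair_curried[OF BF])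
  have Vc: "continuous_on {a..c} V"
    unfolding V_def by (rule continuous_on_integral_triangle(1)[OF Fcont])
  have VX: "V t \<in> closure D" if t: "t \<in> {a..c}" for t
    unfolding V_def
  proof (rule integral_in_closed_subspace[OF subspace_X0 closed_closure])
    show "continuous_on {a..t} (F t)" using t by (intro continuous_on_subset[OF Fr(1)[OF t]]) auto
    show "F t ` {a..t} \<subseteq> closure D" using t by (auto intro!: FX)
  qed
  have BV: "B t (V t) = integral {a..t} (\<lambda>s. B t (F t s))" if t: "t \<in> {a..c}" for t
    unfolding V_def
  proof (rule integral_bounded_linear_on(2)[OF B_linear closed_closure])
    show "continuous_on {a..t} (F t)" using t by (intro continuous_on_subset[OF Fr(1)[OF t]]) auto
    show "F t ` {a..t} \<subseteq> closure D" using t by (auto intro!: FX)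
    show "continuous_on {a..t} (\<lambda>s. B t (F t s))" using t by (intro continuous_on_subset[OF Fr(2)[OF t]]) auto
  qed
  have BVc: "continuous_on {a..c} (\<lambda>r. B r (V r))"
    by (intro B_continuous Vc continuous_intros) (use VX in auto)
  have eq: "integral {a..t} V \<in> D \<and> V t = 0 + A (integral {a..t} V) + integral {a..t} (\<lambda>r. B r (V r) + f r)"
    if t: "t \<in> {a..c}" for t
  proof -
    define W where "W s = integral {s..t} (\<lambda>r. F r s)" for s
    \<comment> \<open>The value of \<open>A (W s)\<close> as read off from the integrated equation
      of \<open>U r s (f s)\<close>. Its continuity in \<open>s\<close> is what allows
      \<open>A\<close> to enter the integral of \<open>W\<close>.\<close>
    define Y where "Y s = F t s - f s - integral {s..t} (\<lambda>r. B r (F r s))" for s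
    have at: "a \<le> t" "t \<le> c" using t by auto
    have Ft: "continuous_on ({a..t} \<times> {a..t}) (\<lambda>(t, s). F t s)"
      "continuous_on ({a..t} \<times> {a..t}) (\<lambda>(t, s). B t (F t s))"
      using Fcont BF sub[OF at(2)] continuous_on_subset by blast+
    have ct: "continuous_on {a..t} g" if "continuous_on {a..c} g" for g :: "real \<Rightarrow> 'a"
      using at by (intro continuous_on_subset[OF that]) auto
    have Wc: "continuous_on {a..t} W"
      unfolding W_def by (rule continuous_on_integral_triangle(2)[OF Ft(1)])
    have IBc: "continuous_on {a..t} (\<lambda>s. integral {s..t} (\<lambda>r. B r (F r s)))"
      by (rule continuous_on_integral_triangle(2)[OF Ft(2)])
    have Yc: "continuous_on {a..t} Y"
      unfolding Y_def by (intro continuous_intros ct[OF Fr(1)[OF t]] ct[OF f(1)] IBc)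
    have WY: "W s \<in> D \<and> A (W s) = Y s" if s: "s \<in> {a..t}" for s
    proof -
      have st: "s \<le> t" "s \<in> {a..c}" using s at by auto
      note u = psol_U[OF fX[OF st(2)] st(1)]
      have tt: "t \<in> {s..t}" using s by simp
      have WU: "W s = integral {s..t} (\<lambda>r. U r s (f s))"
        unfolding W_def F_def by (rule integral_cong) (simp add: max_absorb1)
      have BU: "integral {s..t} (\<lambda>r. B r (F r s)) = integral {s..t} (\<lambda>r. B r (U r s (f s)) + 0)"
        unfolding F_def by (rule integral_cong) (simp add: max_absorb1)
      have "F t s = U t s (f s)" using st by (simp add: F_def max_absorb1)
      then show ?thesis
        using solD(4)[OF u tt] solD(5)[OF u tt] unfolding Y_def WU BU by simp
    qed
    have AWc: "continuous_on {a..t} (\<lambda>s. A (W s))"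
      by (rule continuous_on_eq[OF Yc]) (simp add: WY)
    have IV: "integral {a..t} V = integral {a..t} W"
      unfolding V_def W_def by (rule integral_swap_triangle[OF at(1) Ft(1)])
    have IA: "integral {a..t} W \<in> D" "A (integral {a..t} W) = integral {a..t} (\<lambda>s. A (W s))"
      using integral_A[OF Wc _ AWc] WY by auto
    have "integral {a..t} (\<lambda>s. A (W s)) = integral {a..t} Y" by (rule integral_cong) (simp add: WY)
    also have "\<dots> = integral {a..t} (\<lambda>s. F t s - f s) - integral {a..t} (\<lambda>s. integral {s..t} (\<lambda>r. B r (F r s)))"
      unfolding Y_def
      by (intro integral_diff integrable_continuous_real continuous_intros ct[OF Fr(1)[OF t]] ct[OF f(1)] IBc)
    also have "integral {a..t} (\<lambda>s. F t s - f s) = V t - integral {a..t} f"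
      unfolding V_def by (intro integral_diff integrable_continuous_real ct[OF Fr(1)[OF t]] ct[OF f(1)])
    \<comment> \<open>The second interchange gathers the perturbation terms for fixed
      \<open>r\<close>, where \<open>BV\<close> turns them into \<open>B r (V r)\<close>.\<close>
    also have "integral {a..t} (\<lambda>s. integral {s..t} (\<lambda>r. B r (F r s))) =
        integral {a..t} (\<lambda>r. integral {a..r} (\<lambda>s. B r (F r s)))"
      by (rule integral_swap_triangle[OF at(1) Ft(2), symmetric])
    also have "\<dots> = integral {a..t} (\<lambda>r. B r (V r))"
      by (rule integral_cong) (use BV at in auto)
    finally have "A (integral {a..t} V) = V t - integral {a..t} f - integral {a..t} (\<lambda>r. B r (V r))"
      using IA(2) IV by simp
    moreover have "integral {a..t} (\<lambda>r. B r (V r) + f r) = integral {a..t} (\<lambda>r. B r (V r)) + integral {a..t} f"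
      by (intro integral_add integrable_continuous_real ct[OF BVc] ct[OF f(1)])
    ultimately show ?thesis using IA(1) IV by simp
  qed
  have "psol a c f 0 V"
    unfolding sol_def
    using eq Vc VX by (auto intro!: continuous_intros BVc f(1))
  moreover have "V = (\<lambda>t. integral {a..t} (\<lambda>s. U t s (f s)))"
    unfolding V_def[abs_def] F_def by (intro ext integral_cong) (simp add: max_absorb1)
  ultimately show ?thesis by simp
qed

text \<open>The unperturbed solution with forcing \<open>f\<close> regularizes well: its values over the whole triangle
  stay in a compact subset of \<open>X\<^sub>0\<close>, on which the scaled resolvent converges uniformly to the
  identity. The remaining error is a perturbed solution with small forcing.\<close>

lemma approx_convolution_uniform:
  assumes pq: "p \<le> q" and f: "continuous_on {p..q} f" and e: "e > 0"
  shows "\<forall>\<^sub>F l in at_top. \<forall>t0 t v. p \<le> t0 \<longrightarrow> t0 \<le> t \<longrightarrow> t \<le> q \<longrightarrow> psol t0 t f 0 v \<longrightarrow>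
    norm (approx_convolution D A B f l t t0 - v t) \<le> e"
proof -
  \<comment> \<open>With zero perturbation, \<open>E.U\<close> is the unperturbed evolution family,
    and the continuity results above apply to it.\<close>
  interpret E: perturbed D A \<omega> M \<delta> "\<lambda>_ _. 0" "\<lambda>_. 0"
    by unfold_locales (auto simp: bounded_linear_on_def linear_on_def subspace_X0 intro!: exI[of _ 0])
  obtain S where S: "sol p q f 0 S"
    using sol_exists[OF pq subspace_0[OF subspace_X0] f] by blast
  \<comment> \<open>By linearity the unperturbed zero-start solution from any \<open>s\<close> is
    \<open>S t - E.U t s (S s)\<close> at \<open>t\<close>. So the continuous image of one square
    contains its values for all starting and end times.\<close>
  define K where "K = (\<lambda>(t, s). S (max t s) - E.U (max t s) s (S s)) ` ({p..q} \<times> {p..q})"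
  have SX: "S s \<in> closure D" if "s \<in> {p..q}" for s by (rule solD(3)[OF S that])
  have "continuous_on ({p..q} \<times> {p..q}) (\<lambda>(t, s). S (max t s))"
    unfolding case_prod_unfold
    by (intro continuous_on_compose2[OF solD(2)[OF S]] continuous_intros) auto
  moreover have "continuous_on ({p..q} \<times> {p..q}) (\<lambda>(t, s). E.U (max t s) s (S s))"
    by (rule E.U_continuous[OF solD(2)[OF S]]) (use SX in auto)
  ultimately have "compact K"
    unfolding K_def case_prod_unfold
    by (intro compact_continuous_image continuous_on_diff compact_Times compact_Icc)
  moreover have "K \<subseteq> closure D"
    unfolding K_def by (auto intro!: subspace_diff[OF subspace_X0] E.U_in_X0 SX simp: max_def)
  moreover obtain C where C: "C \<ge> 0" "\<And>a c x f u G t. p \<le> a \<Longrightarrow> c \<le> q \<Longrightarrow> psol a c f x u \<Longrightarrow>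
    (\<And>s. s \<in> {a..c} \<Longrightarrow> norm (f s) \<le> G) \<Longrightarrow> t \<in> {a..c} \<Longrightarrow> norm (u t) \<le> C * (norm x + G)"
    by (rule psol_bound[of p q]) blast
  moreover obtain \<beta> where \<beta>: "\<beta> \<ge> 0" "\<And>s x. s \<in> {p..q} \<Longrightarrow> x \<in> closure D \<Longrightarrow> norm (B s x) \<le> \<beta> * norm x"
    by (rule contraction_step[of p q]) blast
  \<comment> \<open>The perturbed remainder \<open>y\<close> contributes
    \<open>C * \<beta> * e'\<close> and the term \<open>z\<close> contributes
    \<open>e'\<close>.\<close>
  moreover define e' where "e' = e / (C * \<beta> + 1)"
  have "C * \<beta> \<ge> 0" using C(1) \<beta>(1) by simp
  then have e': "e' > 0" "(C * \<beta> + 1) * e' = e" using e by (auto simp: e'_def add_nonneg_eq_0_iff)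
  ultimately have "\<forall>\<^sub>F l in at_top. \<forall>x\<in>K. norm (l *\<^sub>R R l x - x) < e'"
    by (intro scaled_resolvent_uniform_on_compact)
  then show ?thesis
    using eventually_gt_at_top[of \<omega>]
  proof eventually_elim
    case (elim l)
    interpret Rl: bounded_linear "R l" by (rule resolvent_bounded_linear[OF elim(2)])
    show ?case
    proof (intro allI impI)
      fix t0 t v assume t0: "p \<le> t0" and t: "t0 \<le> t" "t \<le> q" and v: "psol t0 t f 0 v"
      define fl where "fl s = l *\<^sub>R R l (f s)" for s
      define Z where "Z r = S r - E.U r t0 (S t0)" for r
      define z where "z r = l *\<^sub>R R l (Z r) - Z r" for r
      define V where "V r = integral {t0..r} (\<lambda>s. U r s (fl s))" for r
      \<comment> \<open>\<open>V - v\<close> and \<open>z\<close> both carry the forcing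
        \<open>fl - f\<close>, which cancels here. Since \<open>V - v = y + z\<close>, the
        perturbation leaves \<open>B r (y r)\<close> and the small forcing
        \<open>B r (z r)\<close>.\<close>
      define y where "y r = V r - v r - z r" for r
      have t0q: "t0 \<in> {p..q}" using t0 t by auto
      have fc: "continuous_on {t0..t} f" using t0 t by (intro continuous_on_subset[OF f]) auto
      have St: "sol t0 t f (S t0) S"
        using t0 t by (intro sol_restrict[OF sol_restart[OF S]]) auto
      have Z: "sol t0 t f 0 Z"
        using sol_diff[OF St E.psol_U[OF SX[OF t0q] t(1)]] unfolding Z_def by simp
      have z: "sol t0 t (\<lambda>s. fl s - f s) 0 z"
        using sol_diff[OF sol_resolvent[OF Z elim(2), of l] Z] unfolding z_def fl_def
        by (simp add: Rl.zero)
      have z_small: "norm (z r) \<le> e'" if r: "r \<in> {t0..t}" for r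
      proof -
        have "Z r \<in> K"
          unfolding K_def Z_def using r t0 t by (intro image_eqI[of _ _ "(r, t0)"]) (auto simp: max_def)
        then show ?thesis using elim(1) unfolding z_def by (simp add: less_imp_le)
      qed
      have "continuous_on {t0..t} fl" unfolding fl_def by (intro continuous_intros Rl.continuous_on fc)
      moreover have "fl ` {t0..t} \<subseteq> closure D"
        unfolding fl_def using D_X0[OF resolvent_in_D[OF elim(2)]]
        by (auto intro!: subspace_scale[OF subspace_X0])
      ultimately have V: "psol t0 t fl 0 V"
        unfolding V_def by (rule variation_of_constants[OF t(1)])
      have VX: "V r \<in> closure D" "v r \<in> closure D" "z r \<in> closure D" if "r \<in> {t0..t}" for r
        using solD(3)[OF V that] solD(3)[OF v that] solD(3)[OF z that] by auto
      have "sol t0 t (\<lambda>r. B r (V r - v r) + (fl r - f r) - (fl r - f r)) (0 - 0 - 0) y"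
        unfolding y_def by (rule sol_diff[OF psol_diff[OF V v] z])
      then have "psol t0 t (\<lambda>r. B r (z r)) (0 - 0 - 0) y"
        by (rule sol_cong) (simp_all add: y_def B_diff VX subspace_diff[OF subspace_X0])
      then have "norm (y t) \<le> C * (norm (0 - 0 - 0 :: 'a) + \<beta> * e')"
      proof (rule C(2)[OF t0 t(2)])
        fix s assume s: "s \<in> {t0..t}"
        have "norm (B s (z s)) \<le> \<beta> * norm (z s)" using s t0 t by (intro \<beta> VX) auto
        also have "\<dots> \<le> \<beta> * e'" by (intro mult_left_mono z_small s \<beta>)
        finally show "norm (B s (z s)) \<le> \<beta> * e'" .
      qed (use t in simp)
      moreover have "approx_convolution D A B f l t t0 - v t = y t + z t"
        by (simp add: approx_convolution_def y_def V_def fl_def)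
      moreover have "norm (y t + z t) \<le> norm (y t) + norm (z t)" by (rule norm_triangle_ineq)
      moreover have "norm (z t) \<le> e'" using t by (intro z_small) simp
      ultimately show "norm (approx_convolution D A B f l t t0 - v t) \<le> e"
        using e'(2) by (simp add: algebra_simps)
    qed
  qed
qed

lemma approx_convolution_tendsto:
  assumes f: "continuous_on {t0..t} f" and t: "t0 \<le> t" and v: "psol t0 t f 0 v"
  shows "((\<lambda>l. approx_convolution D A B f l t t0) \<longlongrightarrow> v t) at_top"
proof (rule tendstoI)
  fix e :: real assume "e > 0"
  then have "e / 2 > 0" by simp
  from approx_convolution_uniform[OF t f this]
  show "\<forall>\<^sub>F l in at_top. dist (approx_convolution D A B f l t t0) (v t) < e"
  proof eventually_elim
    case (elim l)
    then have "norm (approx_convolution D A B f l t t0 - v t) \<le> e / 2" using t v by blast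
    then show ?case using \<open>e > 0\<close> by (simp add: dist_norm)
  qed
qed

text \<open>By linearity, subtracting the homogeneous solution leaves the solution with zero start,
  which is the limit of the convolutions.\<close>

lemma solution_formula:
  assumes x: "x \<in> closure D" and f: "continuous_on {t0..} f"
    and u: "integrated_solution D A B f t0 x u" and t: "t0 \<le> t"
  shows "\<exists>L\<in>closure D. ((\<lambda>l. approx_convolution D A B f l t t0) \<longlongrightarrow> L) at_top \<and> u t = U t t0 x + L"
proof (intro bexI[of _ "u t - U t t0 x"] conjI)
  have ut: "psol t0 t f x u" using u t by (auto simp: integrated_solution_iff_psol[OF f])
  have v: "psol t0 t f 0 (\<lambda>r. u r - U r t0 x)"
    using psol_diff[OF ut psol_U[OF x t]] by simp
  have ft: "continuous_on {t0..t} f" by (intro continuous_on_subset[OF f]) auto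
  show "((\<lambda>l. approx_convolution D A B f l t t0) \<longlongrightarrow> u t - U t t0 x) at_top"
    by (rule approx_convolution_tendsto[OF ft t v])
  show "u t - U t t0 x \<in> closure D" using solD(3)[OF v, of t] t by simp
qed simp

lemma approx_convolution_uniform_limit:
  assumes f: "continuous_on UNIV f"
  shows "uniform_limit {(t, t0). t \<in> {p..q} \<and> t0 \<in> {p..q} \<and> t0 \<le> t}
    (\<lambda>l (t, t0). approx_convolution D A B f l t t0)
    (\<lambda>(t, t0). Lim at_top (\<lambda>l. approx_convolution D A B f l t t0)) at_top"
proof (cases "p \<le> q")
  case True
  have fc: "continuous_on {s..t} f" for s t by (rule continuous_on_subset[OF f]) simp
  show ?thesis
    unfolding uniform_limit_iff
  proof (intro allI impI)
    fix e :: real assume e: "e > 0"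
    then have "e / 2 > 0" by simp
    from approx_convolution_uniform[OF True fc this]
    show "\<forall>\<^sub>F l in at_top. \<forall>z\<in>{(t, t0). t \<in> {p..q} \<and> t0 \<in> {p..q} \<and> t0 \<le> t}.
        dist (case z of (t, t0) \<Rightarrow> approx_convolution D A B f l t t0)
          (case z of (t, t0) \<Rightarrow> Lim at_top (\<lambda>l. approx_convolution D A B f l t t0)) < e"
    proof eventually_elim
      case (elim l)
      have "norm (approx_convolution D A B f l t t0 -
          Lim at_top (\<lambda>l. approx_convolution D A B f l t t0)) < e"
        if t: "t \<in> {p..q}" "t0 \<in> {p..q}" "t0 \<le> t" for t t0
      proof -
        obtain v where v: "psol t0 t f 0 v"
          using psol_exists[OF t(3) subspace_0[OF subspace_X0] fc] by blast
        \<comment> \<open>The value of \<open>Lim\<close> is justified by convergence for this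
          particular pair; the uniform estimate is stated against the same solution
          \<open>v\<close>.\<close>
        have "Lim at_top (\<lambda>l. approx_convolution D A B f l t t0) = v t"
          by (intro tendsto_Lim approx_convolution_tendsto fc t v) simp
        moreover have "norm (approx_convolution D A B f l t t0 - v t) \<le> e / 2"
          using elim t v by auto
        ultimately show ?thesis using e by simp
      qed
      then show ?case by (auto simp: dist_norm)
    qed
  qed
next
  case False
  then have empty: "{(t, t0). t \<in> {p..q} \<and> t0 \<in> {p..q} \<and> t0 \<le> t} = {}" by auto
  show ?thesis unfolding empty by (simp add: uniform_limit_iff)
qed

end

section \<open>From operator norms to pointwise estimates\<close>

lemma norm_le_onorm_on:
  assumes K: "\<And>x. x \<in> S \<Longrightarrow> norm (f x) \<le> K * norm x" and c: "onorm_on S f \<le> c" and x: "x \<in> S"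
  shows "norm (f x) \<le> c * norm x"
proof (cases "x = 0")
  case True
  then show ?thesis using K[OF x] by simp
next
  case False
  \<comment> \<open>The supremum bounds its members only if they are bounded above, which
    \<open>K\<close> ensures. The maximum covers \<open>y = 0\<close>, where the quotient is 0 and
    \<open>K\<close> may be negative.\<close>
  have "norm (f y) / norm y \<le> max K 0" if "y \<in> S" for y
    using K[OF that] by (cases "y = 0") (auto simp: field_simps le_max_iff_disj)
  then have "bdd_above ((\<lambda>y. norm (f y) / norm y) ` S)" by (rule bdd_aboveI2)
  then have "norm (f x) / norm x \<le> onorm_on S f"
    unfolding onorm_on_def by (rule cSUP_upper[OF x])
  also note c
  finally show ?thesis using False by (simp add: field_simps)
qed

lemma resolvent_forcing_of_conditions:
  assumes A: "linear_on D UNIV A" and r: "resolvent_condition D A" and "forcing_condition D A"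
  obtains \<omega> M \<delta> where "resolvent_forcing D A \<omega> M \<delta>"
proof -
  obtain \<delta> :: "real \<Rightarrow> real" where \<delta>: "(\<forall>t\<ge>0. \<delta> t \<ge> 0) \<and> mono_on {0..} \<delta> \<and> (\<delta> \<longlongrightarrow> 0) (at_right 0) \<and>
    (\<forall>\<tau>>0. \<forall>f. continuous_on {0..\<tau>} f \<longrightarrow>
       (\<exists>u. continuous_on {0..\<tau>} u \<and> u ` {0..\<tau>} \<subseteq> closure D \<and>
          (\<forall>t\<in>{0..\<tau>}. integral {0..t} u \<in> D \<and>
             u t = A (integral {0..t} u) + integral {0..t} f \<and>
             norm (u t) \<le> \<delta> t * (SUP s\<in>{0..t}. norm (f s)))))"
    using assms(3) unfolding forcing_condition_def by (rule exE)
  obtain w M where M: "M \<ge> 1" and res: "{w<..} \<subseteq> resolvent_set D A"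
    and pow: "\<forall>l>w. \<forall>k\<ge>1. onorm_on (closure D) (resolvent D A l ^^ k) \<le> M / (l - w) ^ k"
    and lim: "\<forall>x. ((\<lambda>l. resolvent D A l x) \<longlongrightarrow> 0) at_top"
    using r unfolding resolvent_condition_def by blast
  \<comment> \<open>Raising the exponent to a nonnegative one shrinks \<open>l - \<omega>\<close>
    and so weakens the estimates. The case \<open>k = 0\<close> follows from
    \<open>M \<ge> 1\<close>.\<close>
  define \<omega> where "\<omega> = max w 0"
  have "norm ((resolvent D A l ^^ k) x) \<le> M / (l - \<omega>) ^ k * norm x"
    if l: "l > \<omega>" and x: "x \<in> closure D" for l k x
  proof (cases "k = 0")
    case True
    then show ?thesis using M by (simp add: mult_le_cancel_right1)
  next
    case False
    have lw: "l > w" "l - \<omega> \<le> l - w" "0 < l - \<omega>" using l by (auto simp: \<omega>_def)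
    have bl: "bounded_linear (resolvent D A l)" using subsetD[OF res, of l] lw by (simp add: resolvent_set_def)
    \<comment> \<open>Supplies the bound that makes the supremum in \<open>onorm_on\<close>
      meaningful for powers of the resolvent.\<close>
    have "bounded_linear (resolvent D A l ^^ j)" for j
      by (induction j) (auto simp: id_def bounded_linear_ident o_def intro: bounded_linear_compose[OF bl])
    from bounded_linear.bounded[OF this[of k]]
    obtain K where "\<forall>x. norm ((resolvent D A l ^^ k) x) \<le> norm x * K" by (rule exE)
    then have K: "norm ((resolvent D A l ^^ k) y) \<le> K * norm y" for y by (simp add: mult.commute)
    have "onorm_on (closure D) (resolvent D A l ^^ k) \<le> M / (l - w) ^ k" using pow lw False by simp
    from norm_le_onorm_on[OF K this x]
    have "norm ((resolvent D A l ^^ k) x) \<le> M / (l - w) ^ k * norm x" .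
    also have "\<dots> \<le> M / (l - \<omega>) ^ k * norm x"
      using lw M by (intro mult_right_mono divide_left_mono power_mono mult_pos_pos zero_less_power) auto
    finally show ?thesis .
  qed
  moreover have "0 \<le> \<omega>" "l > \<omega> \<Longrightarrow> l \<in> resolvent_set D A" for l using res by (auto simp: \<omega>_def)
  ultimately have "resolvent_forcing D A \<omega> M \<delta>"
    using A M lim \<delta> by unfold_locales auto
  then show ?thesis by (rule that)
qed

theorem theorem1p6:
  fixes D :: "'a::banach set" and A :: "'a \<Rightarrow> 'a" and B :: "real \<Rightarrow> 'a \<Rightarrow> 'a"
  assumes "linear_on D UNIV A"
    and "resolvent_condition D A"
    and "forcing_condition D A"
    and "perturbation_condition D B"
  shows
    "(\<forall>(t0::real) x0 f. x0 \<in> closure D \<longrightarrow> continuous_on {t0..} f \<longrightarrow>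
        (\<exists>u. integrated_solution D A B f t0 x0 u \<and>
           (\<forall>v. integrated_solution D A B f t0 x0 v \<longrightarrow> (\<forall>t\<ge>t0. v t = u t)) \<and>
           (\<forall>t\<ge>t0. \<exists>L\<in>closure D.
              ((\<lambda>l. approx_convolution D A B f l t t0) \<longlongrightarrow> L) at_top \<and>
              u t = evol D A B t t0 x0 + L))) \<and>
     (\<forall>(f::real \<Rightarrow> 'a) a b. continuous_on UNIV f \<longrightarrow>
        uniform_limit {(t, t0). t \<in> {a..b} \<and> t0 \<in> {a..b} \<and> t0 \<le> t}
          (\<lambda>l (t, t0). approx_convolution D A B f l t t0)
          (\<lambda>(t, t0). Lim at_top (\<lambda>l. approx_convolution D A B f l t t0))
          at_top)"
proof -
  obtain \<omega> M \<delta> where rf: "resolvent_forcing D A \<omega> M \<delta>"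
    by (rule resolvent_forcing_of_conditions[OF assms(1-3)])
  obtain b where lin: "\<And>t. bounded_linear_on (closure D) UNIV (B t)"
    and cont: "\<And>x. x \<in> closure D \<Longrightarrow> continuous_on UNIV (\<lambda>t. B t x)"
    and b: "continuous_on UNIV b" "\<And>t. 0 \<le> b t" "\<And>t. onorm_on (closure D) (B t) \<le> b t"
    using assms(4) unfolding perturbation_condition_def by blast
  have bound: "norm (B t x) \<le> b t * norm x" if "x \<in> closure D" for t x
  proof -
    obtain K where "\<And>x. x \<in> closure D \<Longrightarrow> norm (B t x) \<le> K * norm x"
      using lin[of t] by (auto simp: bounded_linear_on_def)
    then show ?thesis using b(3)[of t] that by (rule norm_le_onorm_on)
  qed
  interpret perturbed D A \<omega> M \<delta> B b
    using rf lin cont b(1,2) bound by (intro perturbed.intro perturbed_axioms.intro)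
  show ?thesis
  proof (intro conjI allI impI)
    fix t0 x0 and f :: "real \<Rightarrow> 'a"
    assume x0: "x0 \<in> closure D" and f: "continuous_on {t0..} f"
    obtain u where u: "integrated_solution D A B f t0 x0 u"
      using integrated_solution_exists[OF f x0] by blast
    show "\<exists>u. integrated_solution D A B f t0 x0 u \<and>
        (\<forall>v. integrated_solution D A B f t0 x0 v \<longrightarrow> (\<forall>t\<ge>t0. v t = u t)) \<and>
        (\<forall>t\<ge>t0. \<exists>L\<in>closure D. ((\<lambda>l. approx_convolution D A B f l t t0) \<longlongrightarrow> L) at_top \<and>
          u t = U t t0 x0 + L)"
      using u integrated_solution_unique[OF f _ u] solution_formula[OF x0 f u] by blast
  qed (rule approx_convolution_uniform_limit)
qed

end
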